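(* Let $V$ be a finite-dimensional real vector space, let $\Lambda\subseteq V$ be a full $\mathbb{Z}$-lattice, and let $G$ be a finite group acting linearly on $V$ and mapping $\Lambda$ onto itself, so that $G\leq \mathrm{GL}(\Lambda)$. Let $$V = U_1\oplus\dots\oplus U_r$$ be a decomposition of $V$ into irreducible $\mathbb{R}G$-subspaces. Then the normalizer $\mathbf{N}_{\mathrm{GL}(\Lambda)}(G)$ has finite order if and only if all the $U_i$ are $\Lambda$-rational and the $U_i$ are pairwise non-isomorphic (as $\mathbb{R}G$-modules).
   Context: A full $\mathbb{Z}$-lattice in $V$ is the $\mathbb{Z}$-span of an $\mathbb{R}$-basis of $V$. $\mathrm{GL}(\Lambda)$ is the group of invertible $\mathbb{Z}$-linear maps $\Lambda\to\Lambda$, viewed as a subgroup of $\mathrm{GL}(V)$; $G$ is regarded as a finite subgroup of $\mathrm{GL}(\Lambda)$. The normalizer is $\mathbf{N}_{\mathrm{GL}(\Lambda)}(G)=\{S\in \mathrm{GL}(\Lambda) : S^{-1}gS\in G \text{ for all } g\in G\}$. A subspace $U\leq V$ is $\Lambda$-rational if $U\cap\Lambda$ contains a basis of $U$. *)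

theory Defs
  imports Complex_Main "HOL-Library.FuncSet" "HOL-Algebra.Group"
begin

definition int_span :: "'v::real_vector set \<Rightarrow> 'v set" where
  "int_span B = {(\<Sum>b\<in>T. of_int (c b) *\<^sub>R b) | T (c :: 'v \<Rightarrow> int). finite T \<and> T \<subseteq> B}"

definition full_lattice :: "'v::real_vector set \<Rightarrow> bool" where
  "full_lattice \<Lambda> \<longleftrightarrow> (\<exists>B. independent B \<and> span B = UNIV \<and> \<Lambda> = int_span B)"

text \<open>The group of invertible \<open>\<int>\<close>-linear self-maps of a full lattice \<open>\<Lambda>\<close>, viewed inside
  \<open>GL(V)\<close>: since \<open>\<Lambda>\<close> contains a basis of \<open>V\<close>, each such map is identified with its unique
  \<open>\<real>\<close>-linear extension.\<close>

definition GL_lattice :: "'v::real_vector set \<Rightarrow> ('v \<Rightarrow> 'v) monoid" where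
  "GL_lattice \<Lambda> =
    \<lparr>carrier = {S. linear S \<and> bij S \<and> S ` \<Lambda> = \<Lambda>}, mult = (\<circ>), one = id\<rparr>"

definition lattice_normalizer :: "'v::real_vector set \<Rightarrow> ('v \<Rightarrow> 'v) set \<Rightarrow> ('v \<Rightarrow> 'v) set" where
  "lattice_normalizer \<Lambda> G =
    {S \<in> carrier (GL_lattice \<Lambda>).
      \<forall>g\<in>G. inv\<^bsub>GL_lattice \<Lambda>\<^esub> S \<otimes>\<^bsub>GL_lattice \<Lambda>\<^esub> g \<otimes>\<^bsub>GL_lattice \<Lambda>\<^esub> S \<in> G}"

definition rational_subspace :: "'v::real_vector set \<Rightarrow> 'v set \<Rightarrow> bool" where
  "rational_subspace \<Lambda> U \<longleftrightarrow> (\<exists>B. B \<subseteq> U \<inter> \<Lambda> \<and> independent B \<and> span B = U)"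

definition invariant_subspace :: "('v::real_vector \<Rightarrow> 'v) set \<Rightarrow> 'v set \<Rightarrow> bool" where
  "invariant_subspace G U \<longleftrightarrow> subspace U \<and> (\<forall>g\<in>G. g ` U \<subseteq> U)"

definition irreducible_subspace :: "('v::real_vector \<Rightarrow> 'v) set \<Rightarrow> 'v set \<Rightarrow> bool" where
  "irreducible_subspace G U \<longleftrightarrow> invariant_subspace G U \<and> U \<noteq> {0} \<and>
    (\<forall>W. invariant_subspace G W \<and> W \<subseteq> U \<longrightarrow> W = {0} \<or> W = U)"

definition internal_direct_sum :: "nat \<Rightarrow> (nat \<Rightarrow> 'v::real_vector set) \<Rightarrow> bool" where
  "internal_direct_sum r U \<longleftrightarrow>
    (\<forall>i\<in>{1..r}. subspace (U i)) \<and>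
    (\<forall>v. \<exists>!u. u \<in> (\<Pi>\<^sub>E i\<in>{1..r}. U i) \<and> v = (\<Sum>i=1..r. u i))"

definition isomorphic_submodules ::
    "('v::real_vector \<Rightarrow> 'v) set \<Rightarrow> 'v set \<Rightarrow> 'v set \<Rightarrow> bool" where
  "isomorphic_submodules G U W \<longleftrightarrow> (\<exists>f. bij_betw f U W \<and>
    (\<forall>x\<in>U. \<forall>y\<in>U. f (x + y) = f x + f y) \<and>
    (\<forall>a::real. \<forall>x\<in>U. f (a *\<^sub>R x) = a *\<^sub>R f x) \<and>
    (\<forall>g\<in>G. \<forall>x\<in>U. f (g x) = g (f x)))"

lemma group_GL_lattice: "group (GL_lattice \<Lambda>)"
proof (rule groupI)
  fix S assume S: "S \<in> carrier (GL_lattice \<Lambda>)"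
  then have l: "linear S" and b: "bij S" and i: "S ` \<Lambda> = \<Lambda>"
    by (auto simp: GL_lattice_def)
  obtain T where T: "linear T" "T \<circ> S = id"
    using linear_injective_left_inverse[OF l bij_is_inj[OF b]] by blast
  have "bij T"
    using T(2) b by (metis bij_betw_comp_iff bij_id bij_betw_imp_surj_on)
  moreover have "T ` \<Lambda> = \<Lambda>"
    by (metis T(2) i image_comp image_id id_apply)
  ultimately show "\<exists>T\<in>carrier (GL_lattice \<Lambda>). T \<otimes>\<^bsub>GL_lattice \<Lambda>\<^esub> S = \<one>\<^bsub>GL_lattice \<Lambda>\<^esub>"
    using T by (auto simp: GL_lattice_def)
next
  fix S T assume "S \<in> carrier (GL_lattice \<Lambda>)" "T \<in> carrier (GL_lattice \<Lambda>)"
  then show "S \<otimes>\<^bsub>GL_lattice \<Lambda>\<^esub> T \<in> carrier (GL_lattice \<Lambda>)"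
    by (auto simp: GL_lattice_def linear_compose bij_comp image_comp[symmetric] simp del: o_apply)
qed (auto simp: GL_lattice_def linear_id comp_assoc)

end

theory Submission
  imports Defs "HOL-Analysis.Topology_Euclidean_Space"
begin

text \<open>Conjugation embeds the normalizer of \<open>G\<close> modulo the centralizer of \<open>G\<close> into the permutations of
the finite set \<open>G\<close>, so the question is when the centralizer of \<open>G\<close> in \<open>GL(\<Lambda>)\<close> is finite. That
centralizer is the unit group of the ring \<open>A\<close> of \<open>G\<close>-equivariant linear maps sending \<open>\<Lambda>\<close> into
itself. Averaging matrix units over \<open>G\<close> shows that \<open>A\<close> spans the real algebra \<open>End\<^sub>G(V)\<close>
(lemma \<open>equivariant_expand\<close>), and \<open>A\<close> is discrete in it.

Suppose \<open>A\<close> has finitely many units. An \<open>n\<close> in \<open>A\<close> with \<open>n\<^sup>2 = 0\<close> gives the units \<open>1 + k n\<close>, so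
\<open>n = 0\<close>; consequently an equivariant projection onto a rational invariant subspace commutes with
all of \<open>A\<close>, hence with all of \<open>End\<^sub>G(V)\<close> (lemma \<open>projection_central\<close>). It follows that rational
invariant subspaces are partial sums of the \<open>U\<^sub>i\<close>. Let \<open>W\<close> be a smallest one containing a given
\<open>U\<^sub>i\<close>; then every nonzero element of \<open>A\<close> with image in \<open>W\<close> is bijective on \<open>W\<close>. To see that
\<open>W = U\<^sub>i\<close>, let \<open>e\<close> be the projection onto \<open>U\<^sub>i\<close>, stretch \<open>U\<^sub>i\<close> by \<open>x\<^sub>t = t e + (1 - e)\<close>, and let \<open>a\<^sub>t\<close> be
an element of the ring with image in \<open>W\<close> for which \<open>x\<^sub>t a\<^sub>t\<close> is shortest. A packing argument shows
that the exponent of the ring modulo the right ideal generated by \<open>a\<^sub>t\<close> is bounded independently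
of \<open>t\<close>, so that up to units there are only finitely many \<open>a\<^sub>t\<close> (lemmas \<open>shortest_divides\<close> and
\<open>finite_shortest\<close>). With finitely many units, one \<open>a\<close> is shortest for arbitrarily large \<open>t\<close>. But if
\<open>W\<close> is larger than \<open>U\<^sub>i\<close>, the pigeonhole principle yields \<open>b\<close> with \<open>e b\<close> much smaller than \<open>e a\<close>
(lemma \<open>small_e_part\<close>), and then \<open>x\<^sub>t b\<close> is shorter than \<open>x\<^sub>t a\<close> for large \<open>t\<close>
(lemma \<open>splitting_trivial\<close>). This is the compactness proof of Dirichlet's unit theorem, arranged so
that no determinants or volumes occur. Hence every \<open>U\<^sub>i\<close> is rational; and an isomorphism
\<open>U\<^sub>i \<rightarrow> U\<^sub>j\<close> with \<open>i \<noteq> j\<close>, extended by zero, would fail to commute with the projection onto \<open>U\<^sub>j\<close>.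

Conversely, let the \<open>U\<^sub>i\<close> be rational and pairwise non-isomorphic. By Schur's lemma a unit \<open>c\<close> of
\<open>A\<close> maps each \<open>U\<^sub>i\<close> to itself. If infinitely many restrictions of units to \<open>U\<^sub>i\<close> occurred, their norms
would be unbounded, and a limit point of the normalized restrictions would be a nonzero, hence
invertible, element of \<open>End\<^sub>G(U\<^sub>i)\<close>. Then the inverses of these units would shrink a lattice vector of
\<open>U\<^sub>i\<close> below the length of the shortest one (lemma \<open>finite_unit_restrictions\<close>).\<close>

section \<open>Coordinates, norms and integral maps\<close>

lemma finite_Ints_bounded: "finite {x::real. x \<in> \<int> \<and> \<bar>x\<bar> \<le> c}"
proof (rule finite_subset)
  show "{x::real. x \<in> \<int> \<and> \<bar>x\<bar> \<le> c} \<subseteq> of_int ` {-\<lceil>c\<rceil>..\<lceil>c\<rceil>}"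
  proof
    fix x :: real
    assume "x \<in> {x. x \<in> \<int> \<and> \<bar>x\<bar> \<le> c}"
    then obtain k where "x = of_int k" "\<bar>of_int k :: real\<bar> \<le> c" by (auto elim!: Ints_cases)
    then have "k \<in> {-\<lceil>c\<rceil>..\<lceil>c\<rceil>}"
      by (auto simp: abs_le_iff) linarith+
    then show "x \<in> of_int ` {-\<lceil>c\<rceil>..\<lceil>c\<rceil>}"
      using \<open>x = _\<close> by blast
  qed
qed auto

locale lattice_basis =
  fixes B :: "'v::real_vector set"
  assumes finite_B: "finite B"
    and independent_B: "independent B"
    and span_B: "span B = UNIV"
begin

abbreviation "\<Lambda> \<equiv> int_span B"

definition coord :: "'v \<Rightarrow> 'v \<Rightarrow> real" where
  "coord v b = representation B v b"

lemma coord_add: "coord (v + w) b = coord v b + coord w b"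
  unfolding coord_def by (subst real_vector.representation_add) (auto simp: independent_B span_B)

lemma coord_scaleR: "coord (r *\<^sub>R v) b = r * coord v b"
  unfolding coord_def by (subst real_vector.representation_scale) (auto simp: independent_B span_B)

lemma coord_diff: "coord (v - w) b = coord v b - coord w b"
  unfolding coord_def by (subst real_vector.representation_diff) (auto simp: independent_B span_B)

lemma coord_zero: "coord 0 b = 0"
  unfolding coord_def by (simp add: real_vector.representation_zero)

lemma coord_sum: "coord (\<Sum>i\<in>I. f i) b = (\<Sum>i\<in>I. coord (f i) b)"
  by (induction I rule: infinite_finite_induct) (auto simp: coord_zero coord_add)

lemma coord_basis: "b \<in> B \<Longrightarrow> coord b c = (if c = b then 1 else 0)"
  unfolding coord_def by (subst real_vector.representation_basis) (auto simp: independent_B)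

lemma sum_coord: "(\<Sum>b\<in>B. coord v b *\<^sub>R b) = v"
  unfolding coord_def
  by (rule real_vector.sum_representation_eq) (auto simp: independent_B span_B finite_B)

lemma linear_coord: "linear (\<lambda>v. coord v b *\<^sub>R w)"
  by (intro linearI) (simp_all add: coord_add coord_scaleR scaleR_add_left)

lemma coord_eqI:
  assumes "\<And>b. b \<in> B \<Longrightarrow> coord v b = coord w b"
  shows "v = w"
proof -
  have "(\<Sum>b\<in>B. coord v b *\<^sub>R b) = (\<Sum>b\<in>B. coord w b *\<^sub>R b)"
    by (intro sum.cong) (auto simp: assms)
  then show ?thesis by (simp only: sum_coord)
qed

lemma linear_expand:
  assumes "linear f"
  shows "f v = (\<Sum>b\<in>B. coord v b *\<^sub>R f b)"
proof -
  have "f v = f (\<Sum>b\<in>B. coord v b *\<^sub>R b)" by (simp add: sum_coord)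
  also have "\<dots> = (\<Sum>b\<in>B. coord v b *\<^sub>R f b)"
    by (simp add: linear_sum[OF assms] linear_cmul[OF assms])
  finally show ?thesis .
qed

lemma linear_eqI_basis:
  assumes "linear f" "linear g" "\<And>b. b \<in> B \<Longrightarrow> f b = g b"
  shows "f = g"
proof
  fix v
  have "(\<Sum>b\<in>B. coord v b *\<^sub>R f b) = (\<Sum>b\<in>B. coord v b *\<^sub>R g b)"
    by (intro sum.cong) (auto simp: assms(3))
  then show "f v = g v"
    using linear_expand[OF assms(1), of v] linear_expand[OF assms(2), of v] by simp
qed

lemma mem_lattice_iff: "v \<in> \<Lambda> \<longleftrightarrow> (\<forall>b\<in>B. coord v b \<in> \<int>)"
proof
  assume "v \<in> \<Lambda>"
  then obtain T c where T: "finite T" "T \<subseteq> B" "v = (\<Sum>b\<in>T. of_int (c b) *\<^sub>R b)"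
    unfolding int_span_def by blast
  show "\<forall>b\<in>B. coord v b \<in> \<int>"
    unfolding T(3) coord_sum coord_scaleR using T(2)
    by (intro ballI Ints_sum) (auto simp: coord_basis)
next
  assume "\<forall>b\<in>B. coord v b \<in> \<int>"
  then have "v = (\<Sum>b\<in>B. of_int \<lfloor>coord v b\<rfloor> *\<^sub>R b)"
    by (subst sum_coord[symmetric], intro sum.cong) (auto elim!: Ints_cases)
  then have "\<exists>T c. v = (\<Sum>b\<in>T. of_int (c b) *\<^sub>R b) \<and> finite T \<and> T \<subseteq> B"
    by (intro exI[of _ B] exI[of _ "\<lambda>b. \<lfloor>coord v b\<rfloor>"]) (auto simp: finite_B)
  then show "v \<in> \<Lambda>"
    unfolding int_span_def by blast
qed

lemma lattice_zero: "0 \<in> \<Lambda>"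
  by (simp add: mem_lattice_iff coord_zero)

lemma lattice_add: "v \<in> \<Lambda> \<Longrightarrow> w \<in> \<Lambda> \<Longrightarrow> v + w \<in> \<Lambda>"
  by (simp add: mem_lattice_iff coord_add)

lemma lattice_diff: "v \<in> \<Lambda> \<Longrightarrow> w \<in> \<Lambda> \<Longrightarrow> v - w \<in> \<Lambda>"
  by (simp add: mem_lattice_iff coord_diff)

lemma lattice_scaleR: "r \<in> \<int> \<Longrightarrow> v \<in> \<Lambda> \<Longrightarrow> r *\<^sub>R v \<in> \<Lambda>"
  by (simp add: mem_lattice_iff coord_scaleR)

lemma lattice_sum: "(\<And>i. i \<in> I \<Longrightarrow> f i \<in> \<Lambda>) \<Longrightarrow> (\<Sum>i\<in>I. f i) \<in> \<Lambda>"
  by (induction I rule: infinite_finite_induct) (auto simp: lattice_zero lattice_add)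

lemma basis_in_lattice: "b \<in> B \<Longrightarrow> b \<in> \<Lambda>"
  by (simp add: mem_lattice_iff coord_basis)

lemma lattice_expand:
  assumes "v \<in> \<Lambda>" and "linear f" and "\<And>b. b \<in> B \<Longrightarrow> f b \<in> \<Lambda>"
  shows "f v \<in> \<Lambda>"
  unfolding linear_expand[OF assms(2), of v] using assms(1,3)
  by (intro lattice_sum lattice_scaleR) (auto simp: mem_lattice_iff[of v])

definition vnorm :: "'v \<Rightarrow> real" where
  "vnorm v = (\<Sum>b\<in>B. \<bar>coord v b\<bar>)"

definition opnorm :: "('v \<Rightarrow> 'v) \<Rightarrow> real" where
  "opnorm a = (\<Sum>b\<in>B. vnorm (a b))"

lemma vnorm_nonneg: "0 \<le> vnorm v"
  by (simp add: vnorm_def sum_nonneg)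

lemma vnorm_zero: "vnorm 0 = 0"
  by (simp add: vnorm_def coord_zero)

lemma vnorm_triangle: "vnorm (v + w) \<le> vnorm v + vnorm w"
  unfolding vnorm_def sum.distrib[symmetric]
  by (intro sum_mono) (simp add: coord_add)

lemma vnorm_scaleR: "vnorm (r *\<^sub>R v) = \<bar>r\<bar> * vnorm v"
  by (simp add: vnorm_def coord_scaleR abs_mult sum_distrib_left)

lemma vnorm_triangle_diff: "vnorm (v - w) \<le> vnorm v + vnorm w"
  unfolding vnorm_def sum.distrib[symmetric]
  by (intro sum_mono) (simp add: coord_diff)

lemma vnorm_sum: "vnorm (\<Sum>i\<in>I. f i) \<le> (\<Sum>i\<in>I. vnorm (f i))"
proof (induction I rule: infinite_finite_induct)
  case (insert x F)
  then show ?case using vnorm_triangle[of "f x" "sum f F"] by simp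
qed (auto simp: vnorm_zero)

lemma abs_coord_le_vnorm: "b \<in> B \<Longrightarrow> \<bar>coord v b\<bar> \<le> vnorm v"
  unfolding vnorm_def by (rule member_le_sum) (auto simp: finite_B)

lemma vnorm_eq_zero: "vnorm v = 0 \<Longrightarrow> v = 0"
proof -
  assume "vnorm v = 0"
  then have "coord v b = 0" if "b \<in> B" for b
    using abs_coord_le_vnorm[OF that, of v] by simp
  then show "v = 0"
    by (intro coord_eqI) (simp add: coord_zero)
qed

lemma lattice_vnorm_ge_1:
  assumes "v \<in> \<Lambda>" "v \<noteq> 0"
  shows "1 \<le> vnorm v"
proof -
  obtain b where b: "b \<in> B" "coord v b \<noteq> 0"
    using assms(2) coord_eqI[of v 0] by (auto simp: coord_zero)
  then have "1 \<le> \<bar>coord v b\<bar>"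
    using assms(1) by (auto simp: mem_lattice_iff intro: Ints_nonzero_abs_ge1)
  then show ?thesis using abs_coord_le_vnorm[OF b(1), of v] by linarith
qed

lemma finite_lattice_bounded: "finite {v \<in> \<Lambda>. vnorm v \<le> c}"
proof (rule inj_on_finite)
  show "inj_on (\<lambda>v. restrict (coord v) B) {v \<in> \<Lambda>. vnorm v \<le> c}"
  proof (rule inj_onI)
    fix v w assume "restrict (coord v) B = restrict (coord w) B"
    then have "coord v b = coord w b" if "b \<in> B" for b
      using that by (metis restrict_apply')
    then show "v = w" by (rule coord_eqI)
  qed
  show "(\<lambda>v. restrict (coord v) B) ` {v \<in> \<Lambda>. vnorm v \<le> c} \<subseteq> (\<Pi>\<^sub>E b\<in>B. {x. x \<in> \<int> \<and> \<bar>x\<bar> \<le> c})"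
  proof safe
    fix v b assume "v \<in> \<Lambda>" "vnorm v \<le> c" "b \<in> B"
    then show "restrict (coord v) B b \<in> \<int>" "\<bar>restrict (coord v) B b\<bar> \<le> c"
      using abs_coord_le_vnorm[of b v] by (auto simp: mem_lattice_iff)
  qed auto
  show "finite (\<Pi>\<^sub>E b\<in>B. {x::real. x \<in> \<int> \<and> \<bar>x\<bar> \<le> c})"
    by (intro finite_PiE finite_B finite_Ints_bounded)
qed

lemma opnorm_nonneg: "0 \<le> opnorm a"
  by (simp add: opnorm_def sum_nonneg vnorm_nonneg)

lemma vnorm_apply_le:
  assumes "linear a"
  shows "vnorm (a v) \<le> opnorm a * vnorm v"
proof -
  have "vnorm (a v) \<le> (\<Sum>b\<in>B. vnorm (coord v b *\<^sub>R a b))"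
    unfolding linear_expand[OF assms, of v] by (rule vnorm_sum)
  also have "\<dots> \<le> (\<Sum>b\<in>B. vnorm v * vnorm (a b))"
    unfolding vnorm_scaleR
    by (intro sum_mono mult_right_mono abs_coord_le_vnorm) (auto simp: vnorm_nonneg)
  also have "\<dots> = opnorm a * vnorm v"
    by (simp add: opnorm_def sum_distrib_left sum_distrib_right mult.commute)
  finally show ?thesis .
qed

lemma opnorm_comp_le: "linear a \<Longrightarrow> opnorm (\<lambda>v. a (b v)) \<le> opnorm a * opnorm b"
  unfolding opnorm_def[of "\<lambda>v. a (b v)"] opnorm_def[of b] sum_distrib_left
  by (intro sum_mono vnorm_apply_le)

lemma opnorm_triangle: "opnorm (\<lambda>v. a v + b v) \<le> opnorm a + opnorm b"
  unfolding opnorm_def sum.distrib[symmetric] by (intro sum_mono vnorm_triangle)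

lemma opnorm_triangle_diff: "opnorm (\<lambda>v. a v - b v) \<le> opnorm a + opnorm b"
  unfolding opnorm_def sum.distrib[symmetric] by (intro sum_mono vnorm_triangle_diff)

lemma opnorm_scaleR: "opnorm (\<lambda>v. r *\<^sub>R a v) = \<bar>r\<bar> * opnorm a"
  by (simp add: opnorm_def vnorm_scaleR sum_distrib_left)

lemma opnorm_sum: "opnorm (\<lambda>v. \<Sum>i\<in>I. a i v) \<le> (\<Sum>i\<in>I. opnorm (a i))"
  unfolding opnorm_def
  by (subst sum.swap) (intro sum_mono vnorm_sum)

lemma opnorm_eq_zero: "linear a \<Longrightarrow> opnorm a = 0 \<Longrightarrow> a v = 0"
  using vnorm_apply_le[of a v] vnorm_nonneg[of "a v"] vnorm_eq_zero[of "a v"] by simp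

definition integral_map :: "('v \<Rightarrow> 'v) \<Rightarrow> bool" where
  "integral_map a \<longleftrightarrow> linear a \<and> a ` \<Lambda> \<subseteq> \<Lambda>"

lemma finite_integral_bounded: "finite {a. integral_map a \<and> opnorm a \<le> c}"
proof (rule inj_on_finite)
  show "inj_on (\<lambda>a. restrict a B) {a. integral_map a \<and> opnorm a \<le> c}"
  proof (rule inj_onI)
    fix a b assume ab: "a \<in> {a. integral_map a \<and> opnorm a \<le> c}" "b \<in> {a. integral_map a \<and> opnorm a \<le> c}"
      "restrict a B = restrict b B"
    then have "a x = b x" if "x \<in> B" for x
      using that by (metis restrict_apply')
    moreover have "linear a" "linear b" using ab by (auto simp: integral_map_def)
    ultimately show "a = b" by (intro linear_eqI_basis)
  qed
  show "(\<lambda>a. restrict a B) ` {a. integral_map a \<and> opnorm a \<le> c} \<subseteq> (\<Pi>\<^sub>E b\<in>B. {v \<in> \<Lambda>. vnorm v \<le> c})"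
  proof safe
    fix a b assume a: "integral_map a" "opnorm a \<le> c" and b: "b \<in> B"
    then show "restrict a B b \<in> \<Lambda>"
      using basis_in_lattice by (auto simp: integral_map_def)
    have "vnorm (a b) \<le> opnorm a"
      unfolding opnorm_def using b by (intro member_le_sum) (auto simp: vnorm_nonneg finite_B)
    then show "vnorm (restrict a B b) \<le> c" using a b by simp
  qed auto
  show "finite (\<Pi>\<^sub>E b\<in>B. {v \<in> \<Lambda>. vnorm v \<le> c})"
    by (intro finite_PiE finite_B finite_lattice_bounded)
qed

text \<open>The pigeonhole principle in the space of matrices, with a number \<open>N\<close> depending only on the norm bound
and the required distance. This uniformity is what makes the index bound in \<open>shortest_divides\<close>
independent of the stretching parameter.\<close>

lemma opnorm_close_pair:
  assumes "\<delta> > 0"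
  shows "\<exists>N::nat. \<forall>z::nat \<Rightarrow> 'v \<Rightarrow> 'v. (\<forall>k. opnorm (z k) \<le> c) \<longrightarrow>
    (\<exists>k l. k < l \<and> l \<le> N \<and> opnorm (\<lambda>v. z l v - z k v) < \<delta>)"
proof -
  \<comment> \<open>Matrix entries are rounded to multiples of \<open>1 / K\<close>. A matrix has \<open>card B * card B\<close> entries, so
    two matrices with the same rounding have distance less than \<open>\<delta>\<close>.\<close>
  define K where "K = (real (card B) * real (card B) + 1) / \<delta>"
  have K: "K > 0" using assms by (simp add: K_def add_nonneg_pos)
  define P where "P = (\<Pi>\<^sub>E p\<in>B\<times>B. {-\<lceil>K * c\<rceil> - 1..\<lceil>K * c\<rceil> + 1})"
  have fP: "finite P" unfolding P_def by (intro finite_PiE) (auto simp: finite_B)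
  have "\<exists>k l. k < l \<and> l \<le> card P \<and> opnorm (\<lambda>v. z l v - z k v) < \<delta>"
    if z: "\<forall>k. opnorm (z k) \<le> c" for z :: "nat \<Rightarrow> 'v \<Rightarrow> 'v"
  proof -
    define h where "h k = (\<lambda>p\<in>B\<times>B. \<lfloor>K * coord (z k (fst p)) (snd p)\<rfloor>)" for k
    have "h k \<in> P" for k
    proof -
      have "\<lfloor>K * coord (z k b) b'\<rfloor> \<in> {-\<lceil>K * c\<rceil> - 1..\<lceil>K * c\<rceil> + 1}" if "b \<in> B" "b' \<in> B" for b b'
      proof -
        have "vnorm (z k b) \<le> opnorm (z k)"
          unfolding opnorm_def using that by (intro member_le_sum) (auto simp: vnorm_nonneg finite_B)
        then have "\<bar>coord (z k b) b'\<bar> \<le> c"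
          using abs_coord_le_vnorm[OF that(2), of "z k b"] z[rule_format, of k] by linarith
        then have "\<bar>K * coord (z k b) b'\<bar> \<le> K * c"
          using K by (simp add: abs_mult)
        then show ?thesis unfolding atLeastAtMost_iff by linarith
      qed
      then show ?thesis unfolding h_def P_def by (auto simp: PiE_iff)
    qed
    then have "\<not> inj_on h {..card P}"
      using fP card_inj_on_le[of h "{..card P}" P] by auto
    then obtain k l where kl: "k < l" "l \<le> card P" "h k = h l"
      unfolding inj_on_def by (metis atMost_iff linorder_less_linear)
    have close: "\<bar>coord (z l b - z k b) b'\<bar> \<le> 1 / K" if "b \<in> B" "b' \<in> B" for b b'
    proof -
      have "\<lfloor>K * coord (z k b) b'\<rfloor> = \<lfloor>K * coord (z l b) b'\<rfloor>"
        using fun_cong[OF kl(3), of "(b, b')"] that by (simp add: h_def)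
      then have "\<bar>K * coord (z l b) b' - K * coord (z k b) b'\<bar> \<le> 1" by linarith
      then have "K * \<bar>coord (z l b - z k b) b'\<bar> \<le> 1"
        using K by (simp add: coord_diff abs_mult right_diff_distrib[symmetric])
      then show ?thesis using K by (simp add: field_simps)
    qed
    have "opnorm (\<lambda>v. z l v - z k v) \<le> (\<Sum>b\<in>B. \<Sum>b'\<in>B. 1 / K)"
      unfolding opnorm_def vnorm_def by (intro sum_mono close)
    also have "\<dots> = (real (card B) * real (card B)) / K" by simp
    also have "\<dots> < \<delta>"
      using assms K by (simp add: K_def divide_less_eq add_nonneg_pos)
    finally show ?thesis using kl by blast
  qed
  then show ?thesis by blast
qed

text \<open>A basis vector \<open>b\<close> is a real combination of elements of \<open>D\<close>. Subtracting from \<open>k b\<close> the combination with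
the coefficients rounded down leaves lattice vectors of bounded length, so two values of \<open>k\<close>
leave the same one; their difference multiplies \<open>b\<close> into the integer span of \<open>D\<close>. In other words, the real
coefficients may be taken rational; this is what makes a map that is integral on \<open>D\<close> rational.\<close>

lemma real_span_imp_integral_multiple:
  assumes D: "D \<subseteq> \<Lambda>" "span D = UNIV" and e: "linear e" "e ` D \<subseteq> \<Lambda>"
  shows "\<exists>m::nat. m > 0 \<and> integral_map (\<lambda>v. real m *\<^sub>R e v)"
proof -
  have "\<exists>k::nat. k > 0 \<and> real k *\<^sub>R e b \<in> \<Lambda>" if "b \<in> B" for b
  proof -
    have "b \<in> span D" using D(2) by simp
    then obtain t r where t: "finite t" "t \<subseteq> D" and b: "b = (\<Sum>a\<in>t. r a *\<^sub>R a)"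
      unfolding span_explicit by blast
    define c where "c k a = \<lfloor>real k * r a\<rfloor>" for k :: nat and a
    define z where "z k = real k *\<^sub>R b - (\<Sum>a\<in>t. of_int (c k a) *\<^sub>R a)" for k :: nat
    have "z k \<in> {v \<in> \<Lambda>. vnorm v \<le> (\<Sum>a\<in>t. vnorm a)}" for k
    proof -
      have "z k \<in> \<Lambda>"
        unfolding z_def using t D(1) basis_in_lattice[OF \<open>b \<in> B\<close>]
        by (intro lattice_diff lattice_scaleR lattice_sum) auto
      have "real k *\<^sub>R b = (\<Sum>a\<in>t. (real k * r a) *\<^sub>R a)"
        using arg_cong[OF b, of "scaleR (real k)"] by (simp add: scaleR_sum_right)
      then have z: "z k = (\<Sum>a\<in>t. (real k * r a - of_int (c k a)) *\<^sub>R a)"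
        unfolding z_def by (simp add: sum_subtractf scaleR_diff_left)
      have "vnorm ((real k * r a - of_int (c k a)) *\<^sub>R a) \<le> vnorm a" for a
      proof -
        have "\<bar>real k * r a - of_int (c k a)\<bar> \<le> 1" unfolding c_def by linarith
        then show ?thesis
          using mult_right_mono[of "\<bar>real k * r a - of_int (c k a)\<bar>" 1 "vnorm a"] vnorm_nonneg[of a]
          by (simp add: vnorm_scaleR)
      qed
      then have "vnorm (z k) \<le> (\<Sum>a\<in>t. vnorm a)"
        unfolding z by (intro order_trans[OF vnorm_sum] sum_mono)
      with \<open>z k \<in> \<Lambda>\<close> show ?thesis by blast
    qed
    then have "range z \<subseteq> {v \<in> \<Lambda>. vnorm v \<le> (\<Sum>a\<in>t. vnorm a)}"
      by (rule image_subsetI)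
    then have "finite (range z)"
      using finite_lattice_bounded by (rule finite_subset)
    then have "\<not> inj z"
      using finite_imageD infinite_UNIV_nat by blast
    then obtain k l where kl: "k < l" "z k = z l"
      unfolding inj_def by (metis linorder_less_linear)
    have "real (l - k) *\<^sub>R b = (\<Sum>a\<in>t. of_int (c l a - c k a) *\<^sub>R a)"
      using kl by (simp add: z_def of_nat_diff scaleR_diff_left sum_subtractf algebra_simps)
    then have "real (l - k) *\<^sub>R e b = e (\<Sum>a\<in>t. of_int (c l a - c k a) *\<^sub>R a)"
      by (metis e(1) linear_cmul)
    also have "\<dots> = (\<Sum>a\<in>t. of_int (c l a - c k a) *\<^sub>R e a)"
      by (simp only: linear_sum[OF e(1)] linear_cmul[OF e(1)])
    also have "\<dots> \<in> \<Lambda>"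
      using t e(2) by (intro lattice_sum lattice_scaleR) auto
    finally show ?thesis using kl(1) by (intro exI[of _ "l - k"]) simp
  qed
  then obtain k where k: "\<And>b. b \<in> B \<Longrightarrow> k b > (0::nat)" "\<And>b. b \<in> B \<Longrightarrow> real (k b) *\<^sub>R e b \<in> \<Lambda>"
    by metis
  define m where "m = (\<Prod>b\<in>B. k b)"
  have "real m *\<^sub>R e b \<in> \<Lambda>" if "b \<in> B" for b
  proof -
    have eq: "real m *\<^sub>R e b = real (\<Prod>c\<in>B - {b}. k c) *\<^sub>R (real (k b) *\<^sub>R e b)"
      using prod.remove[OF finite_B that, of k] by (simp add: m_def mult.commute)
    show ?thesis unfolding eq by (rule lattice_scaleR[OF _ k(2)[OF that]]) (simp only: Ints_of_nat)
  qed
  moreover have "linear (\<lambda>v. real m *\<^sub>R e v)"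
    by (rule linear_compose_scale_right[OF e(1)])
  ultimately have "integral_map (\<lambda>v. real m *\<^sub>R e v)"
    unfolding integral_map_def by (meson image_subsetI lattice_expand)
  moreover have "m > 0" using k(1) by (simp add: m_def prod_pos)
  ultimately show ?thesis by blast
qed

end

section \<open>Equivariant lattice endomorphisms\<close>

locale lattice_group = lattice_basis +
  fixes G :: "('a \<Rightarrow> 'a) set"
  assumes finite_G: "finite G"
    and subgroup_G: "subgroup G (GL_lattice \<Lambda>)"
begin

abbreviation ginv :: "('a \<Rightarrow> 'a) \<Rightarrow> 'a \<Rightarrow> 'a" where
  "ginv g \<equiv> inv_into UNIV g"

lemma GL_inv:
  assumes "S \<in> carrier (GL_lattice \<Lambda>)"
  shows "inv\<^bsub>GL_lattice \<Lambda>\<^esub> S = ginv S"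
proof -
  interpret group "GL_lattice \<Lambda>" by (rule group_GL_lattice)
  have "inv\<^bsub>GL_lattice \<Lambda>\<^esub> S \<circ> S = id"
    using l_inv[OF assms] by (simp add: GL_lattice_def)
  moreover have "surj S" using assms by (auto simp: GL_lattice_def bij_is_surj)
  ultimately show ?thesis
    by (metis (no_types, lifting) ext comp_apply id_apply surj_f_inv_f)
qed

lemma G_carrier: "g \<in> G \<Longrightarrow> g \<in> carrier (GL_lattice \<Lambda>)"
  using subgroup.mem_carrier[OF subgroup_G] .

lemma G_linear: "g \<in> G \<Longrightarrow> linear g"
  and G_bij: "g \<in> G \<Longrightarrow> bij g"
  and G_lattice: "g \<in> G \<Longrightarrow> g ` \<Lambda> = \<Lambda>"
  using G_carrier[of g] by (auto simp: GL_lattice_def)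

lemma G_comp: "g \<in> G \<Longrightarrow> h \<in> G \<Longrightarrow> g \<circ> h \<in> G"
  using subgroup.m_closed[OF subgroup_G, of g h] by (simp add: GL_lattice_def)

lemma G_id: "id \<in> G"
  using subgroup.one_closed[OF subgroup_G] by (simp add: GL_lattice_def)

lemma G_ginv: "g \<in> G \<Longrightarrow> ginv g \<in> G"
  using subgroup.m_inv_closed[OF subgroup_G, of g] GL_inv[OF G_carrier, of g] by simp

lemma ginv_left: "g \<in> G \<Longrightarrow> ginv g (g v) = v"
  by (simp add: G_bij bij_is_inj)

lemma ginv_right: "g \<in> G \<Longrightarrow> g (ginv g v) = v"
  by (simp add: G_bij bij_is_surj surj_f_inv_f)

lemma G_lattice_mem: "g \<in> G \<Longrightarrow> v \<in> \<Lambda> \<Longrightarrow> g v \<in> \<Lambda>"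
  using G_lattice[of g] by blast

lemma card_G_pos: "card G > 0"
  using G_id finite_G card_gt_0_iff by blast

definition equivariant :: "('a \<Rightarrow> 'a) \<Rightarrow> bool" where
  "equivariant a \<longleftrightarrow> linear a \<and> (\<forall>g\<in>G. \<forall>v. a (g v) = g (a v))"

definition lattice_endo :: "('a \<Rightarrow> 'a) \<Rightarrow> bool" where
  "lattice_endo a \<longleftrightarrow> equivariant a \<and> integral_map a"

lemma equivariant_linear: "equivariant a \<Longrightarrow> linear a"
  by (simp add: equivariant_def)

lemma equivariant_commute: "equivariant a \<Longrightarrow> g \<in> G \<Longrightarrow> a (g v) = g (a v)"
  by (simp add: equivariant_def)

lemma equivariant_comp: "equivariant a \<Longrightarrow> equivariant b \<Longrightarrow> equivariant (\<lambda>v. a (b v))"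
  using linear_compose[of b a] by (simp add: equivariant_def o_def)

lemma equivariant_add: "equivariant a \<Longrightarrow> equivariant b \<Longrightarrow> equivariant (\<lambda>v. a v + b v)"
  by (simp add: equivariant_def linear_compose_add linear_add[OF G_linear])

lemma equivariant_diff: "equivariant a \<Longrightarrow> equivariant b \<Longrightarrow> equivariant (\<lambda>v. a v - b v)"
  by (simp add: equivariant_def linear_compose_sub linear_diff[OF G_linear])

lemma equivariant_scaleR: "equivariant a \<Longrightarrow> equivariant (\<lambda>v. r *\<^sub>R a v)"
  by (simp add: equivariant_def linear_compose_scale_right linear_cmul[OF G_linear])

lemma equivariant_ident: "equivariant (\<lambda>v. v)"
  by (simp add: equivariant_def linear_ident)

lemma equivariant_zero: "equivariant (\<lambda>v. 0)"
  by (simp add: equivariant_def linear_zero linear_0[OF G_linear])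

lemma lattice_endoI: "equivariant a \<Longrightarrow> (\<And>v. v \<in> \<Lambda> \<Longrightarrow> a v \<in> \<Lambda>) \<Longrightarrow> lattice_endo a"
  by (auto simp: lattice_endo_def integral_map_def equivariant_linear)

lemma lattice_endo_equivariant: "lattice_endo a \<Longrightarrow> equivariant a"
  by (simp add: lattice_endo_def)

lemma lattice_endo_mem: "lattice_endo a \<Longrightarrow> v \<in> \<Lambda> \<Longrightarrow> a v \<in> \<Lambda>"
  by (auto simp: lattice_endo_def integral_map_def)

lemma lattice_endo_comp: "lattice_endo a \<Longrightarrow> lattice_endo b \<Longrightarrow> lattice_endo (\<lambda>v. a (b v))"
  by (rule lattice_endoI) (simp_all only: equivariant_comp lattice_endo_equivariant lattice_endo_mem)

lemma lattice_endo_add: "lattice_endo a \<Longrightarrow> lattice_endo b \<Longrightarrow> lattice_endo (\<lambda>v. a v + b v)"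
  by (rule lattice_endoI) (simp_all only: equivariant_add lattice_add lattice_endo_equivariant lattice_endo_mem)

lemma lattice_endo_diff: "lattice_endo a \<Longrightarrow> lattice_endo b \<Longrightarrow> lattice_endo (\<lambda>v. a v - b v)"
  by (rule lattice_endoI) (simp_all only: equivariant_diff lattice_diff lattice_endo_equivariant lattice_endo_mem)

lemma lattice_endo_scaleR: "lattice_endo a \<Longrightarrow> r \<in> \<int> \<Longrightarrow> lattice_endo (\<lambda>v. r *\<^sub>R a v)"
  by (rule lattice_endoI) (simp_all only: equivariant_scaleR lattice_scaleR lattice_endo_equivariant lattice_endo_mem)

lemma lattice_endo_ident: "lattice_endo (\<lambda>v. v)"
  by (rule lattice_endoI) (simp_all only: equivariant_ident)

lemma lattice_endo_zero: "lattice_endo (\<lambda>v. 0)"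
  by (rule lattice_endoI) (simp_all only: equivariant_zero lattice_zero)

lemma lattice_endo_sum: "(\<And>i. i \<in> I \<Longrightarrow> lattice_endo (a i)) \<Longrightarrow> lattice_endo (\<lambda>v. \<Sum>i\<in>I. a i v)"
  by (induction I rule: infinite_finite_induct) (auto simp: lattice_endo_zero lattice_endo_add)

text \<open>Averaging over \<open>G\<close> without the factor \<open>1 / card G\<close>, so that integral maps stay integral.\<close>

definition gsum :: "('a \<Rightarrow> 'a) \<Rightarrow> 'a \<Rightarrow> 'a" where
  "gsum f = (\<lambda>v. \<Sum>g\<in>G. g (f (ginv g v)))"

lemma linear_gsum:
  assumes "linear f"
  shows "linear (gsum f)"
proof -
  have "linear (g \<circ> (f \<circ> ginv g))" if "g \<in> G" for g
    using linear_compose[OF linear_compose[OF G_linear[OF G_ginv[OF that]] assms] G_linear[OF that]] .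
  then have "\<forall>g\<in>G. linear (\<lambda>v. g (f (ginv g v)))"
    by (simp only: o_def Ball_def) blast
  then show ?thesis
    unfolding gsum_def by (rule linear_compose_sum)
qed

lemma gsum_commute:
  assumes h: "h \<in> G"
  shows "gsum f (h v) = h (gsum f v)"
proof -
  have bij: "bij_betw (\<lambda>g. h \<circ> g) G G"
  proof (rule bij_betwI[where g = "\<lambda>g. ginv h \<circ> g"])
    show "(\<lambda>g. h \<circ> g) \<in> G \<rightarrow> G" "(\<lambda>g. ginv h \<circ> g) \<in> G \<rightarrow> G"
      by (intro Pi_I G_comp h G_ginv; assumption)+
  qed (auto simp: fun_eq_iff ginv_left[OF h] ginv_right[OF h])
  have "ginv (h \<circ> g) (h v) = ginv g v" if "g \<in> G" for g
    using ginv_left[OF G_comp[OF h that], of "ginv g v"] by (simp add: ginv_right[OF that])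
  then have "(\<Sum>g\<in>G. (h \<circ> g) (f (ginv (h \<circ> g) (h v)))) = (\<Sum>g\<in>G. h (g (f (ginv g v))))"
    by (intro sum.cong) auto
  then show "gsum f (h v) = h (gsum f v)"
    unfolding gsum_def linear_sum[OF G_linear[OF h]]
    using sum.reindex_bij_betw[OF bij, of "\<lambda>g. g (f (ginv g (h v)))"] by simp
qed

lemma equivariant_gsum: "linear f \<Longrightarrow> equivariant (gsum f)"
  unfolding equivariant_def by (intro conjI ballI allI linear_gsum gsum_commute)

lemma gsum_equivariant: "equivariant f \<Longrightarrow> gsum f v = real (card G) *\<^sub>R f v"
  by (simp add: gsum_def equivariant_commute[OF _ G_ginv] ginv_right sum_constant_scaleR)

lemma lattice_endo_gsum:
  assumes "integral_map f"
  shows "lattice_endo (gsum f)"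
proof (rule lattice_endoI)
  show "equivariant (gsum f)"
    using assms by (intro equivariant_gsum) (simp add: integral_map_def)
  show "gsum f v \<in> \<Lambda>" if "v \<in> \<Lambda>" for v
    unfolding gsum_def
  proof (rule lattice_sum)
    fix g assume g: "g \<in> G"
    have "f (ginv g v) \<in> \<Lambda>"
      using assms G_lattice_mem[OF G_ginv[OF g] that] by (auto simp: integral_map_def)
    then show "g (f (ginv g v)) \<in> \<Lambda>" by (rule G_lattice_mem[OF g])
  qed
qed

text \<open>The \<open>G\<close>-average of the matrix unit of the pair \<open>p\<close>. These finitely many integral equivariant maps span
all equivariant maps, see \<open>equivariant_expand\<close>.\<close>

definition unit_sum :: "'a \<times> 'a \<Rightarrow> 'a \<Rightarrow> 'a" where
  "unit_sum p = gsum (\<lambda>v. coord v (fst p) *\<^sub>R snd p)"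

lemma lattice_endo_unit_sum: "p \<in> B \<times> B \<Longrightarrow> lattice_endo (unit_sum p)"
  unfolding unit_sum_def
  by (rule lattice_endo_gsum)
    (auto simp: integral_map_def linear_coord mem_lattice_iff coord_scaleR coord_basis)

text \<open>Averaging fixes an equivariant map up to the factor \<open>card G\<close> and is linear, so the expansion of \<open>y\<close> into
matrix units turns into an expansion into their averages.\<close>

lemma equivariant_expand:
  assumes "equivariant y"
  shows "y v = (\<Sum>p\<in>B \<times> B. (coord (y (fst p)) (snd p) / real (card G)) *\<^sub>R unit_sum p v)"
proof -
  have y: "y w = (\<Sum>p\<in>B \<times> B. coord (y (fst p)) (snd p) *\<^sub>R (coord w (fst p) *\<^sub>R snd p))" for w
  proof -
    have "y w = (\<Sum>b\<in>B. coord w b *\<^sub>R (\<Sum>c\<in>B. coord (y b) c *\<^sub>R c))"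
      using linear_expand[OF equivariant_linear[OF assms], of w] by (simp add: sum_coord)
    also have "\<dots> = (\<Sum>p\<in>B \<times> B. coord (y (fst p)) (snd p) *\<^sub>R (coord w (fst p) *\<^sub>R snd p))"
      by (simp add: scaleR_sum_right sum.cartesian_product case_prod_beta mult.commute)
    finally show ?thesis .
  qed
  have "real (card G) *\<^sub>R y v = (\<Sum>g\<in>G. g (y (ginv g v)))"
    using gsum_equivariant[OF assms, of v] by (simp add: gsum_def)
  also have "\<dots> = (\<Sum>g\<in>G. \<Sum>p\<in>B \<times> B. coord (y (fst p)) (snd p) *\<^sub>R g (coord (ginv g v) (fst p) *\<^sub>R snd p))"
    by (intro sum.cong refl, subst y) (simp only: linear_sum[OF G_linear] linear_cmul[OF G_linear])
  also have "\<dots> = (\<Sum>p\<in>B \<times> B. coord (y (fst p)) (snd p) *\<^sub>R unit_sum p v)"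
    by (subst sum.swap) (simp add: unit_sum_def gsum_def scaleR_sum_right)
  finally have *: "real (card G) *\<^sub>R y v = (\<Sum>p\<in>B \<times> B. coord (y (fst p)) (snd p) *\<^sub>R unit_sum p v)" .
  have "y v = (1 / real (card G)) *\<^sub>R (real (card G) *\<^sub>R y v)"
    using card_G_pos by simp
  then show ?thesis unfolding * by (simp add: scaleR_sum_right)
qed

lemma commute_equivariant:
  assumes "linear a" and "\<And>b v. lattice_endo b \<Longrightarrow> a (b v) = b (a v)" and y: "equivariant y"
  shows "a (y v) = y (a v)"
  unfolding equivariant_expand[OF y, of v] equivariant_expand[OF y, of "a v"]
  by (simp add: linear_sum[OF assms(1)] linear_cmul[OF assms(1)] assms(2) lattice_endo_unit_sum)

definition rational_invariant :: "'a set \<Rightarrow> bool" where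
  "rational_invariant W \<longleftrightarrow> rational_subspace \<Lambda> W \<and> invariant_subspace G W"

definition projection_onto :: "('a \<Rightarrow> 'a) \<Rightarrow> 'a set \<Rightarrow> bool" where
  "projection_onto p W \<longleftrightarrow> (\<forall>v. p v \<in> W) \<and> (\<forall>w\<in>W. p w = w)"

text \<open>Maschke's theorem over the rationals. Extending a lattice basis of \<open>W\<close> by basis vectors of \<open>\<Lambda>\<close> gives
a rational projection onto \<open>W\<close>; averaging makes it equivariant and keeps it rational.\<close>

lemma rational_invariant_projection:
  assumes "rational_invariant W"
  obtains p m where "equivariant p" "projection_onto p W" "m > (0::nat)"
    "lattice_endo (\<lambda>v. real m *\<^sub>R p v)"
proof -
  obtain C where C: "C \<subseteq> W \<inter> \<Lambda>" "independent C" "span C = W"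
    using assms by (auto simp: rational_invariant_def rational_subspace_def)
  obtain D where D: "C \<subseteq> D" "D \<subseteq> C \<union> B" "independent D" "C \<union> B \<subseteq> span D"
    using real_vector.maximal_independent_subset_extend[of C "C \<union> B"] C(2) by blast
  have "span D = UNIV"
    using span_mono[OF D(4)] span_B span_mono[of B "C \<union> B"] by (auto simp: span_span)
  obtain q where q: "linear q" "\<And>x. x \<in> D \<Longrightarrow> q x = (if x \<in> C then x else 0)"
    using linear_independent_extend[OF D(3), of "\<lambda>x. if x \<in> C then x else 0"] by blast
  have DL: "D \<subseteq> \<Lambda>" "q ` D \<subseteq> \<Lambda>"
    using C(1) D(2) basis_in_lattice q(2) lattice_zero by auto
  obtain m where m: "m > 0" "integral_map (\<lambda>v. real m *\<^sub>R q v)"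
    using real_span_imp_integral_multiple[OF DL(1) \<open>span D = UNIV\<close> q(1) DL(2)] by blast
  have W: "subspace W" "\<And>g w. g \<in> G \<Longrightarrow> w \<in> W \<Longrightarrow> g w \<in> W"
    using assms by (auto simp: rational_invariant_def invariant_subspace_def)
  have "q ` D \<subseteq> W"
    using q(2) C(1) subspace_0[OF W(1)] by auto
  then have qW: "q v \<in> W" for v
  proof -
    have "range q \<subseteq> W"
      using linear_span_image[OF q(1), of D] span_minimal[OF \<open>q ` D \<subseteq> W\<close> W(1)] \<open>span D = UNIV\<close>
      by simp
    then show ?thesis by blast
  qed
  have "q w = w" if "w \<in> W" for w
  proof (rule linear_eq_on_span[OF q(1) linear_ident])
    show "q x = x" if "x \<in> C" for x using q(2) D(1) that by auto
    show "w \<in> span C" using that C(3) by simp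
  qed
  then have qid: "g (q (ginv g w)) = w" if "w \<in> W" "g \<in> G" for g w
    using W(2)[OF G_ginv[OF that(2)] that(1)] ginv_right[OF that(2)] by simp
  define p where "p v = (1 / real (card G)) *\<^sub>R gsum q v" for v
  show thesis
  proof
    show "equivariant p"
      unfolding p_def by (intro equivariant_scaleR equivariant_gsum q)
    have "p v \<in> W" for v
      unfolding p_def gsum_def
      by (rule subspace_scale[OF W(1) subspace_sum[OF W(1) W(2)[OF _ qW]]])
    moreover have "p w = w" if "w \<in> W" for w
    proof -
      have "gsum q w = (\<Sum>g\<in>G. w)"
        unfolding gsum_def by (intro sum.cong refl qid that)
      then show ?thesis
        using card_G_pos by (simp add: p_def sum_constant_scaleR)
    qed
    ultimately show "projection_onto p W" by (simp add: projection_onto_def)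
    show "card G * m > 0" using card_G_pos m(1) by simp
    have "real (card G * m) *\<^sub>R p v = gsum (\<lambda>v. real m *\<^sub>R q v) v" for v
      using card_G_pos by (simp add: p_def gsum_def linear_cmul[OF G_linear] scaleR_sum_right)
    then show "lattice_endo (\<lambda>v. real (card G * m) *\<^sub>R p v)"
      by (simp only: lattice_endo_gsum[OF m(2)])
  qed
qed

lemma equivariant_image_invariant:
  assumes "equivariant a" "invariant_subspace G W"
  shows "invariant_subspace G (a ` W)"
  unfolding invariant_subspace_def
proof (intro conjI ballI)
  show "subspace (a ` W)"
    using assms by (intro linear_subspace_image equivariant_linear) (auto simp: invariant_subspace_def)
  show "g ` a ` W \<subseteq> a ` W" if "g \<in> G" for g
  proof clarify
    fix w assume "w \<in> W"
    then have "g w \<in> W" using assms(2) that by (auto simp: invariant_subspace_def)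
    then show "g (a w) \<in> a ` W"
      using equivariant_commute[OF assms(1) that, of w] by (metis imageI)
  qed
qed

lemma rational_invariant_range:
  assumes "lattice_endo a"
  shows "rational_invariant (range a)"
  unfolding rational_invariant_def
proof
  have lin: "linear a" using assms by (simp add: lattice_endo_def equivariant_def)
  obtain C where C: "C \<subseteq> a ` B" "independent C" "a ` B \<subseteq> span C"
    using real_vector.maximal_independent_subset[of "a ` B"] by blast
  have "span C = span (a ` B)"
    using span_mono[OF C(1)] span_mono[OF C(3)] by (simp add: span_span)
  also have "\<dots> = range a"
    using linear_span_image[OF lin, of B] span_B by simp
  finally have "span C = range a" .
  moreover have "C \<subseteq> range a \<inter> \<Lambda>"
    using C(1) lattice_endo_mem[OF assms] basis_in_lattice by blast
  ultimately show "rational_subspace \<Lambda> (range a)"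
    using C(2) unfolding rational_subspace_def by blast
  show "invariant_subspace G (range a)"
    using assms by (intro equivariant_image_invariant lattice_endo_equivariant)
      (auto simp: invariant_subspace_def)
qed

end

section \<open>Finitely many units make rational projections central\<close>

context lattice_group begin

definition lattice_unit :: "('a \<Rightarrow> 'a) \<Rightarrow> bool" where
  "lattice_unit a \<longleftrightarrow> lattice_endo a \<and>
    (\<exists>b. lattice_endo b \<and> (\<forall>v. a (b v) = v) \<and> (\<forall>v. b (a v) = v))"

lemma lattice_unit_inverse:
  assumes "lattice_unit c"
  obtains b where "lattice_unit b" "\<And>v. c (b v) = v" "\<And>v. b (c v) = v"
  using assms unfolding lattice_unit_def by blast

lemma lattice_unit_endo: "lattice_unit c \<Longrightarrow> lattice_endo c"
  by (simp add: lattice_unit_def)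

text \<open>The maps \<open>1 + k n\<close> are units with inverses \<open>1 - k n\<close>, and they are distinct if \<open>n \<noteq> 0\<close>.\<close>

lemma nilpotent_eq_zero:
  assumes fin: "finite {a. lattice_unit a}" and n: "lattice_endo n" "\<And>v. n (n v) = 0"
  shows "n v = 0"
proof (rule ccontr)
  assume nv: "n v \<noteq> 0"
  note lin = equivariant_linear[OF lattice_endo_equivariant[OF n(1)]]
  define u where "u k = (\<lambda>v. v + real_of_int k *\<^sub>R n v)" for k
  have endo: "lattice_endo (u k)" for k
    unfolding u_def by (intro lattice_endo_add lattice_endo_ident lattice_endo_scaleR n(1)) simp
  have inverse: "u k (u (- k) w) = w" for k w
    by (simp add: u_def linear_add[OF lin] linear_cmul[OF lin] linear_diff[OF lin] n(2))
  have "lattice_unit (u k)" for k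
    unfolding lattice_unit_def using endo[of k] endo[of "- k"] inverse[of k] inverse[of "- k"]
    by (intro conjI exI[of _ "u (- k)"]) auto
  then have "range u \<subseteq> {a. lattice_unit a}" by blast
  with fin have "finite (range u)" by (rule finite_subset[rotated])
  moreover have "inj u"
  proof (rule injI)
    fix k l assume "u k = u l"
    then have "u k v = u l v" by simp
    then show "k = l" using nv by (simp add: u_def)
  qed
  ultimately show False
    using finite_imageD infinite_UNIV_int by blast
qed

text \<open>With \<open>q = 1 - p\<close>, the maps \<open>p b q\<close> and \<open>q b p\<close> square to zero for every lattice endomorphism \<open>b\<close>, and
so do suitable integral multiples of them. Hence both vanish, that is, \<open>p b = p b p = b p\<close>.\<close>

lemma projection_central:
  assumes fin: "finite {a. lattice_unit a}"
    and p: "equivariant p" "projection_onto p W" "m > (0::nat)" "lattice_endo (\<lambda>v. real m *\<^sub>R p v)"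
    and a: "equivariant a"
  shows "p (a v) = a (p v)"
proof (rule commute_equivariant[OF equivariant_linear[OF p(1)] _ a])
  fix b v assume b: "lattice_endo b"
  note linp = equivariant_linear[OF p(1)]
  note linb = equivariant_linear[OF lattice_endo_equivariant[OF b]]
  have pp: "p (p w) = p w" for w
    using p(2) by (simp add: projection_onto_def)
  define q where "q = (\<lambda>v. real m *\<^sub>R v - real m *\<^sub>R p v)"
  have q: "lattice_endo q"
    unfolding q_def by (intro lattice_endo_diff p lattice_endo_scaleR lattice_endo_ident) simp
  note simps = linear_diff[OF linp] linear_cmul[OF linp] linear_diff[OF linb] linear_cmul[OF linb]
    linear_0[OF linb] linear_0[OF linp] pp
  have "(\<lambda>v. real m *\<^sub>R p (b (q v))) w = 0" for w
    by (rule nilpotent_eq_zero[OF fin lattice_endo_comp[OF p(4) lattice_endo_comp[OF b q]]])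
      (simp add: q_def simps)
  then have 1: "p (b w) = p (b (p w))" for w
    using p(3) by (simp add: q_def simps)
  have "(\<lambda>v. q (b (real m *\<^sub>R p v))) w = 0" for w
    by (rule nilpotent_eq_zero[OF fin lattice_endo_comp[OF q lattice_endo_comp[OF b p(4)]]])
      (simp add: q_def simps)
  then have 2: "b (p w) = p (b (p w))" for w
    using p(3) by (simp add: q_def simps)
  show "p (b v) = b (p v)" using 1 2 by metis
qed

end

section \<open>Shortest endomorphisms of a minimal rational subspace\<close>

text \<open>The setting in which units are produced: \<open>W\<close> is a rational invariant subspace with a central projection
\<open>p\<close> and is minimal in the sense of \<open>simple\<close>, while \<open>e\<close> splits a real submodule off \<open>W\<close>. The aim is
to show that finitely many units force the splitting to be trivial.\<close>

locale rational_splitting = lattice_group +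
  fixes W :: "'a set" and p e :: "'a \<Rightarrow> 'a" and m :: nat
  assumes equivariant_p: "equivariant p" and p_onto: "projection_onto p W" and m_pos: "m > 0"
    and endo_p: "lattice_endo (\<lambda>v. real m *\<^sub>R p v)"
    and p_central: "\<And>a v. equivariant a \<Longrightarrow> p (a v) = a (p v)"
    and simple: "\<And>a v. lattice_endo a \<Longrightarrow> (\<And>w. a w \<in> W) \<Longrightarrow> a v \<noteq> 0 \<Longrightarrow> range a = W"
    and equivariant_e: "equivariant e" and e_idem: "\<And>v. e (e v) = e v" and e_in: "\<And>v. e v \<in> W"
begin

text \<open>The ring of lattice endomorphisms with image in \<open>W\<close>. Over the rationals it spans the endomorphism
algebra of \<open>W\<close>, whose identity is \<open>p\<close>; in general only multiples of \<open>p\<close> are integral. By minimality of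
\<open>W\<close> that algebra is a division algebra, see \<open>W_endo_inj\<close>.\<close>

definition W_endo :: "('a \<Rightarrow> 'a) \<Rightarrow> bool" where
  "W_endo a \<longleftrightarrow> lattice_endo a \<and> (\<forall>v. a v \<in> W)"

lemma W_endo_lattice_endo: "W_endo a \<Longrightarrow> lattice_endo a"
  by (simp add: W_endo_def)

lemma W_endo_equivariant: "W_endo a \<Longrightarrow> equivariant a"
  by (simp add: W_endo_def lattice_endo_def)

lemma W_endo_linear: "W_endo a \<Longrightarrow> linear a"
  by (simp add: W_endo_equivariant equivariant_linear)

lemma W_endo_mem: "W_endo a \<Longrightarrow> a v \<in> W"
  by (simp add: W_endo_def)

lemma p_in: "p v \<in> W" and p_ident: "w \<in> W \<Longrightarrow> p w = w"
  using p_onto by (auto simp: projection_onto_def)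

lemma linear_p: "linear p" and linear_e: "linear e"
  using equivariant_p equivariant_e by (auto simp: equivariant_linear)

lemma W_range: "W = range p"
  using p_in p_ident by (metis rangeI subsetI subset_antisym image_subsetI)

lemma subspace_W: "subspace W"
  unfolding W_range by (rule linear_subspace_image[OF linear_p subspace_UNIV])

lemma apply_p: "equivariant a \<Longrightarrow> (\<And>v. a v \<in> W) \<Longrightarrow> a (p v) = a v"
  using p_central[of a v] p_ident by metis

lemma W_endo_diff: "W_endo a \<Longrightarrow> W_endo b \<Longrightarrow> W_endo (\<lambda>v. a v - b v)"
  by (simp add: W_endo_def lattice_endo_diff subspace_diff[OF subspace_W])

lemma W_endo_scaleR: "W_endo a \<Longrightarrow> r \<in> \<int> \<Longrightarrow> W_endo (\<lambda>v. r *\<^sub>R a v)"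
  by (simp add: W_endo_def lattice_endo_scaleR subspace_scale[OF subspace_W])

lemma W_endo_sum: "(\<And>i. i \<in> I \<Longrightarrow> W_endo (a i)) \<Longrightarrow> W_endo (\<lambda>v. \<Sum>i\<in>I. a i v)"
  by (simp add: W_endo_def lattice_endo_sum subspace_sum[OF subspace_W])

lemma W_endo_comp: "W_endo a \<Longrightarrow> W_endo b \<Longrightarrow> W_endo (\<lambda>v. a (b v))"
  by (simp add: W_endo_def lattice_endo_comp)

lemma W_endo_p: "W_endo (\<lambda>v. real m *\<^sub>R p v)"
  by (simp add: W_endo_def endo_p subspace_scale[OF subspace_W] p_in)

lemma W_endo_range: "W_endo a \<Longrightarrow> a v \<noteq> 0 \<Longrightarrow> range a = W"
  using simple[of a v] by (simp add: W_endo_def)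

text \<open>The map \<open>a\<close> sends \<open>W\<close> onto \<open>W\<close> by minimality and vanishes on the kernel of \<open>p\<close>, so \<open>a + (1 - p)\<close> is
surjective on \<open>V\<close>, hence injective by finite dimension.\<close>

lemma W_endo_inj:
  assumes a: "W_endo a" "a v \<noteq> 0" and w: "w \<in> W" "a w = 0"
  shows "w = 0"
proof -
  interpret finite_dimensional_vector_space "scaleR :: real \<Rightarrow> 'a \<Rightarrow> 'a" B
    using finite_B independent_B span_B
    by unfold_locales (auto simp: dependent_raw_def span_raw_def algebra_simps)
  define h where "h = (\<lambda>x. a x + (x - p x))"
  have lin: "linear h"
    unfolding h_def using W_endo_linear[OF a(1)] linear_p
    by (intro linear_compose_add linear_compose_sub linear_ident)
  have ap: "a (p x) = a x" for x
    using apply_p[OF W_endo_equivariant[OF a(1)]] W_endo_mem[OF a(1)] by blast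
  have "\<exists>x. h x = y" for y
  proof -
    obtain u where u: "p y = a u"
      using W_endo_range[OF a] p_in[of y] by (metis rangeE)
    have "a (y - p y) = 0"
      using ap[of y] by (simp add: linear_diff[OF W_endo_linear[OF a(1)]])
    then have "h (p u + (y - p y)) = y"
      using u ap[of u] p_ident[OF p_in] p_ident[OF W_endo_mem[OF a(1)]]
      by (simp add: h_def linear_add[OF linear_p] linear_diff[OF linear_p] linear_add[OF W_endo_linear[OF a(1)]])
    then show ?thesis ..
  qed
  then have "surj h" by (metis surjI)
  then have "inj h" using linear_surj_imp_inj[OF lin[unfolded Real_Vector_Spaces.linear_def]] by simp
  moreover have "h w = h 0"
    using w p_ident[OF w(1)] by (simp add: h_def linear_0[OF linear_p] linear_0[OF W_endo_linear[OF a(1)]])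
  ultimately show ?thesis by (simp add: inj_eq)
qed

text \<open>The quotient \<open>a\<^sup>-\<^sup>1 z\<close> on \<open>W\<close>. It is equivariant but in general no longer integral.\<close>

lemma W_endo_divide:
  assumes a: "W_endo a" "a v0 \<noteq> 0" and z: "equivariant z" "\<And>v. z v \<in> W"
  obtains y where "equivariant y" "\<And>v. y v \<in> W" "\<And>v. a (y v) = z v"
proof -
  have "inj_on a W"
  proof (rule inj_onI)
    fix x y assume xy: "x \<in> W" "y \<in> W" "a x = a y"
    then have "a (x - y) = 0" by (simp add: linear_diff[OF W_endo_linear[OF a(1)]])
    then have "x - y = 0"
      by (rule W_endo_inj[OF a subspace_diff[OF subspace_W xy(1,2)]])
    then show "x = y" by simp
  qed
  then obtain g where g: "range g \<subseteq> W" "linear g" "\<And>w. w \<in> W \<Longrightarrow> g (a w) = w"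
    using linear_exists_left_inverse_on[OF W_endo_linear[OF a(1)] subspace_W] by blast
  have ap: "a (p x) = a x" for x
    using apply_p[OF W_endo_equivariant[OF a(1)]] W_endo_mem[OF a(1)] by blast
  have ag: "a (g w) = w" if w: "w \<in> W" for w
  proof -
    obtain u where "w = a u" using W_endo_range[OF a] w by (metis rangeE)
    then have "w = a (p u)" by (simp add: ap)
    then show ?thesis using g(3)[OF p_in] by metis
  qed
  have W_inv: "h w \<in> W" if "h \<in> G" "w \<in> W" for h w
    using equivariant_commute[OF equivariant_p that(1), of w] p_ident[OF that(2)] p_in by metis
  define y where "y = (\<lambda>v. g (z v))"
  have y_in: "y v \<in> W" for v using g(1) by (auto simp: y_def)
  have ay: "a (y v) = z v" for v using ag[OF z(2)] by (simp add: y_def)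
  have "y (h v) = h (y v)" if h: "h \<in> G" for h v
  proof -
    have "a (y (h v)) = a (h (y v))"
      using ay equivariant_commute[OF z(1) h] equivariant_commute[OF W_endo_equivariant[OF a(1)] h] by metis
    then show ?thesis
      using \<open>inj_on a W\<close> y_in W_inv[OF h y_in] by (auto dest: inj_onD)
  qed
  moreover have "linear y"
    using linear_compose[OF equivariant_linear[OF z(1)] g(2)] by (simp add: y_def o_def)
  ultimately have "equivariant y" by (simp add: equivariant_def)
  then show thesis using that y_in ay by blast
qed

text \<open>Generators, over the reals, of the equivariant maps with image in \<open>W\<close>.\<close>

definition gen :: "'a \<times> 'a \<Rightarrow> 'a \<Rightarrow> 'a" where
  "gen q v = real m *\<^sub>R p (unit_sum q v)"

lemma W_endo_gen: "q \<in> B \<times> B \<Longrightarrow> W_endo (gen q)"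
  unfolding W_endo_def gen_def[abs_def]
  by (simp add: lattice_endo_comp[OF endo_p lattice_endo_unit_sum] subspace_scale[OF subspace_W] p_in)

lemma gen_expand:
  assumes "equivariant y" "\<And>v. y v \<in> W"
  obtains c where "\<And>v. y v = (\<Sum>q\<in>B \<times> B. c q *\<^sub>R gen q v)"
proof
  fix v
  have "y v = p (y v)" using p_ident[OF assms(2)] by simp
  also have "\<dots> = (\<Sum>q\<in>B \<times> B. (coord (y (fst q)) (snd q) / real (card G)) *\<^sub>R p (unit_sum q v))"
    by (subst equivariant_expand[OF assms(1)]) (simp only: linear_sum[OF linear_p] linear_cmul[OF linear_p])
  also have "\<dots> = (\<Sum>q\<in>B \<times> B. (coord (y (fst q)) (snd q) / (real (card G) * real m)) *\<^sub>R gen q v)"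
    using m_pos by (intro sum.cong) (auto simp: gen_def)
  finally show "y v = (\<Sum>q\<in>B \<times> B. (coord (y (fst q)) (snd q) / (real (card G) * real m)) *\<^sub>R gen q v)" .
qed

definition int_part :: "('a \<times> 'a \<Rightarrow> real) \<Rightarrow> 'a \<Rightarrow> 'a" where
  "int_part c v = (\<Sum>q\<in>B \<times> B. of_int \<lfloor>c q\<rfloor> *\<^sub>R gen q v)"

definition gen_bound :: real where
  "gen_bound = (\<Sum>q\<in>B \<times> B. opnorm (gen q))"

lemma W_endo_int_part: "W_endo (int_part c)"
  unfolding int_part_def[abs_def] by (rule W_endo_sum) (simp add: W_endo_scaleR W_endo_gen)

text \<open>Every equivariant map with image in \<open>W\<close> lies within a fixed distance of an integral one.\<close>

lemma opnorm_frac_part: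
  "opnorm (\<lambda>v. (\<Sum>q\<in>B \<times> B. c q *\<^sub>R gen q v) - int_part c v) \<le> gen_bound"
proof -
  have "opnorm (\<lambda>v. (\<Sum>q\<in>B \<times> B. c q *\<^sub>R gen q v) - int_part c v)
      = opnorm (\<lambda>v. \<Sum>q\<in>B \<times> B. frac (c q) *\<^sub>R gen q v)"
    by (simp add: int_part_def sum_subtractf[symmetric] scaleR_diff_left[symmetric] frac_def)
  also have "\<dots> \<le> (\<Sum>q\<in>B \<times> B. opnorm (\<lambda>v. frac (c q) *\<^sub>R gen q v))"
    by (rule opnorm_sum)
  also have "\<dots> \<le> gen_bound"
    unfolding gen_bound_def
  proof (rule sum_mono)
    fix q
    have "frac (c q) * opnorm (gen q) \<le> 1 * opnorm (gen q)"
      using frac_lt_1[of "c q"] by (intro mult_right_mono opnorm_nonneg) simp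
    then show "opnorm (\<lambda>v. frac (c q) *\<^sub>R gen q v) \<le> opnorm (gen q)"
      by (simp add: opnorm_scaleR)
  qed
  finally show ?thesis .
qed

text \<open>Dirichlet approximation. The integral maps close to multiples of \<open>p - e\<close> have bounded \<open>e\<close>-part, because
\<open>e (p - e) = 0\<close>. By the pigeonhole principle the \<open>e\<close>-parts of two of them nearly agree, and the
difference is nonzero because the multiples are chosen far apart.\<close>

lemma small_e_part:
  assumes ne: "p v0 \<noteq> e v0" and "\<delta> > 0"
  obtains b v1 where "W_endo b" "b v1 \<noteq> 0" "opnorm (\<lambda>v. e (b v)) < \<delta>"
proof -
  define y where "y = (\<lambda>v. p v - e v)"
  have y: "equivariant y" "\<And>v. y v \<in> W"
    unfolding y_def
    by (simp_all add: equivariant_diff equivariant_p equivariant_e subspace_diff[OF subspace_W] p_in e_in)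
  have ey: "e (y v) = 0" for v
    using apply_p[OF equivariant_e e_in] by (simp add: y_def linear_diff[OF linear_e] e_idem)
  obtain c where c: "\<And>v. y v = (\<Sum>q\<in>B \<times> B. c q *\<^sub>R gen q v)"
    using gen_expand[OF y] by blast
  have y_pos: "opnorm y > 0"
    using opnorm_eq_zero[OF equivariant_linear[OF y(1)], of v0] opnorm_nonneg[of y] ne
    by (auto simp: y_def less_le)
  \<comment> \<open>The step width \<open>s\<close> makes the rounded multiples of \<open>s y\<close> pairwise distinct.\<close>
  obtain s :: nat where s: "2 * gen_bound < real s * opnorm y"
    using reals_Archimedean3[OF y_pos] by blast
  define z where "z k = int_part (\<lambda>q. real (k * s) * c q)" for k
  have frac: "opnorm (\<lambda>v. real (k * s) *\<^sub>R y v - z k v) \<le> gen_bound" for k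
    using opnorm_frac_part[of "\<lambda>q. real (k * s) * c q"]
    by (simp add: z_def c scaleR_sum_right)
  have ez: "opnorm (\<lambda>v. e (z k v)) \<le> opnorm e * gen_bound" for k
  proof -
    have "opnorm (\<lambda>v. e (z k v)) = opnorm (\<lambda>v. e (real (k * s) *\<^sub>R y v - z k v))"
      using vnorm_scaleR[of "-1"] by (simp add: linear_diff[OF linear_e] linear_cmul[OF linear_e] ey opnorm_def)
    also have "\<dots> \<le> opnorm e * opnorm (\<lambda>v. real (k * s) *\<^sub>R y v - z k v)"
      by (rule opnorm_comp_le[OF linear_e])
    also have "\<dots> \<le> opnorm e * gen_bound"
      by (rule mult_left_mono[OF frac opnorm_nonneg])
    finally show ?thesis .
  qed
  obtain N :: nat where N: "\<forall>z. (\<forall>k. opnorm (z k) \<le> opnorm e * gen_bound) \<longrightarrow>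
      (\<exists>k l. k < l \<and> l \<le> N \<and> opnorm (\<lambda>v. z l v - z k v) < \<delta>)"
    using opnorm_close_pair[OF \<open>\<delta> > 0\<close>] by blast
  obtain k l where kl: "k < l" "opnorm (\<lambda>v. e (z l v) - e (z k v)) < \<delta>"
    using N[rule_format, of "\<lambda>k v. e (z k v)", OF ez] by blast
  define b where "b = (\<lambda>v. z l v - z k v)"
  have "W_endo b"
    unfolding b_def z_def by (intro W_endo_diff W_endo_int_part)
  moreover have "opnorm (\<lambda>v. e (b v)) < \<delta>"
    using kl(2) by (simp add: b_def linear_diff[OF linear_e])
  moreover have "\<exists>v. b v \<noteq> 0"
  proof (rule ccontr)
    assume "\<not> (\<exists>v. b v \<noteq> 0)"
    then have b0: "z l v = z k v" for v by (simp add: b_def)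
    have "real ((l - k) * s) *\<^sub>R y v =
        (real (l * s) *\<^sub>R y v - z l v) - (real (k * s) *\<^sub>R y v - z k v)" for v
      using kl(1) b0[of v] by (simp add: of_nat_diff algebra_simps)
    then have "opnorm (\<lambda>v. real ((l - k) * s) *\<^sub>R y v) \<le> gen_bound + gen_bound"
      using order_trans[OF opnorm_triangle_diff add_mono[OF frac[of l] frac[of k]]] by simp
    then have "real (l - k) * (real s * opnorm y) \<le> 2 * gen_bound"
      by (simp add: opnorm_scaleR)
    moreover have "1 * (real s * opnorm y) \<le> real (l - k) * (real s * opnorm y)"
      using kl(1) y_pos by (intro mult_right_mono) auto
    ultimately show False using s by simp
  qed
  ultimately show thesis using that by blast
qed

definition stretch :: "nat \<Rightarrow> 'a \<Rightarrow> 'a" where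
  "stretch t v = real t *\<^sub>R e v + (v - e v)"

text \<open>The map \<open>a\<close> yields a shortest nonzero vector of the lattice of all \<open>x\<^sub>t b\<close>, with \<open>x\<^sub>t\<close> the stretching map and
\<open>b\<close> integral with image in \<open>W\<close>.\<close>

definition shortest :: "nat \<Rightarrow> ('a \<Rightarrow> 'a) \<Rightarrow> bool" where
  "shortest t a \<longleftrightarrow> W_endo a \<and> (\<exists>v. a v \<noteq> 0) \<and>
    (\<forall>b. W_endo b \<and> (\<exists>v. b v \<noteq> 0) \<longrightarrow> opnorm (\<lambda>v. stretch t (a v)) \<le> opnorm (\<lambda>v. stretch t (b v)))"

lemma linear_stretch: "linear (stretch t)"
  unfolding stretch_def[abs_def]
  by (intro linear_compose_add linear_compose_sub linear_ident linear_compose_scale_right linear_e)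

lemma stretch_inverse:
  assumes "t > 0"
  obtains s where "linear s" "\<And>v. s (stretch t v) = v"
proof
  define s where "s = (\<lambda>v. (1 / real t) *\<^sub>R e v + (v - e v))"
  show "linear s" unfolding s_def
    by (intro linear_compose_add linear_compose_sub linear_ident linear_compose_scale_right linear_e)
  show "s (stretch t v) = v" for v
    using assms by (simp add: s_def stretch_def linear_add[OF linear_e] linear_diff[OF linear_e] 
        linear_cmul[OF linear_e] e_idem)
qed

text \<open>Since the stretching map is invertible, only finitely many integral maps have a stretched version of
bounded norm.\<close>

lemma ex_shortest:
  assumes "t > 0" and W0: "p v0 \<noteq> 0"
  obtains a where "shortest t a"
proof -
  obtain s where s: "linear s" "\<And>v. s (stretch t v) = v"
    using stretch_inverse[OF \<open>t > 0\<close>] by blast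
  define c where "c = opnorm (\<lambda>v. stretch t (real m *\<^sub>R p v))"
  define S where "S = {a. W_endo a \<and> (\<exists>v. a v \<noteq> 0) \<and> opnorm (\<lambda>v. stretch t (a v)) \<le> c}"
  have "S \<subseteq> {a. integral_map a \<and> opnorm a \<le> opnorm s * c}"
  proof
    fix a assume "a \<in> S"
    then have a: "W_endo a" "opnorm (\<lambda>v. stretch t (a v)) \<le> c" by (auto simp: S_def)
    have "opnorm a = opnorm (\<lambda>v. s (stretch t (a v)))" by (simp add: s(2))
    also have "\<dots> \<le> opnorm s * opnorm (\<lambda>v. stretch t (a v))" by (rule opnorm_comp_le[OF s(1)])
    also have "\<dots> \<le> opnorm s * c" by (rule mult_left_mono[OF a(2) opnorm_nonneg])
    finally show "a \<in> {a. integral_map a \<and> opnorm a \<le> opnorm s * c}"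
      using a(1) by (simp add: W_endo_def lattice_endo_def)
  qed
  then have fin: "finite S"
    using finite_integral_bounded by (rule finite_subset)
  have mem: "(\<lambda>v. real m *\<^sub>R p v) \<in> S"
    unfolding S_def using W_endo_p W0 m_pos by (auto simp: c_def)
  then have "S \<noteq> {}" by blast
  define f where "f = (\<lambda>a. opnorm (\<lambda>v. stretch t (a v)))"
  obtain a where "a \<in> S" and "\<And>b. b \<in> S \<Longrightarrow> f a \<le> f b"
    using arg_min_if_finite(1)[OF fin \<open>S \<noteq> {}\<close>, of f] arg_min_least[OF fin \<open>S \<noteq> {}\<close>, of _ f] by metis
  then have a: "a \<in> S" "\<And>b. b \<in> S \<Longrightarrow> opnorm (\<lambda>v. stretch t (a v)) \<le> opnorm (\<lambda>v. stretch t (b v))"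
    by (simp_all only: f_def)
  have "opnorm (\<lambda>v. stretch t (a v)) \<le> opnorm (\<lambda>v. stretch t (b v))"
    if "W_endo b" "\<exists>v. b v \<noteq> 0" for b
  proof (cases "b \<in> S")
    case False
    then have "c \<le> opnorm (\<lambda>v. stretch t (b v))" using that by (simp add: S_def)
    moreover have "opnorm (\<lambda>v. stretch t (a v)) \<le> c" using a(1) by (simp add: S_def)
    ultimately show ?thesis by simp
  qed (use a(2) in blast)
  then have "shortest t a"
    using a(1) by (simp add: shortest_def S_def)
  then show thesis using that by blast
qed

text \<open>Packing. Write \<open>z = a y\<close> with \<open>y\<close> equivariant, and reduce the multiples \<open>k z\<close> modulo the right ideal of \<open>a\<close> by
rounding \<open>k y\<close> down. After stretching and division by the minimal norm \<open>\<mu>\<close>, the remainders have norm at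
most \<open>gen_bound\<close>, while distinct remainders have distance at least \<open>1\<close>. So among a number of
multiples that does not depend on \<open>t\<close>, two leave the same remainder.\<close>

lemma shortest_divides:
  obtains N :: nat where "N > 0"
    "\<And>t a z. t > 0 \<Longrightarrow> shortest t a \<Longrightarrow> W_endo z \<Longrightarrow> \<exists>y. W_endo y \<and> (\<forall>v. real N *\<^sub>R z v = a (y v))"
proof -
  obtain N :: nat where N: "\<forall>z. (\<forall>k. opnorm (z k) \<le> gen_bound) \<longrightarrow>
      (\<exists>k l. k < l \<and> l \<le> N \<and> opnorm (\<lambda>v. z l v - z k v) < 1)"
    using opnorm_close_pair[of 1] by (metis zero_less_one)
  have main: "\<exists>y. W_endo y \<and> (\<forall>v. real (fact N) *\<^sub>R z v = a (y v))"
    if t: "t > 0" and a: "shortest t a" and z: "W_endo z" for t a z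
  proof -
    obtain v0 where aR: "W_endo a" and v0: "a v0 \<noteq> 0" using a by (auto simp: shortest_def)
    note lina = W_endo_linear[OF aR]
    obtain y0 where y0: "equivariant y0" "\<And>v. y0 v \<in> W" "\<And>v. a (y0 v) = z v"
      using W_endo_divide[OF aR v0 W_endo_equivariant[OF z] W_endo_mem[OF z]] by blast
    obtain c where c: "\<And>v. y0 v = (\<Sum>q\<in>B \<times> B. c q *\<^sub>R gen q v)"
      using gen_expand[OF y0(1,2)] by blast
    define \<mu> where "\<mu> = opnorm (\<lambda>v. stretch t (a v))"
    have lin_sa: "linear (\<lambda>v. stretch t (a v))"
      using linear_compose[OF lina linear_stretch] by (simp add: o_def)
    have \<mu>: "\<mu> > 0"
    proof (rule ccontr)
      assume "\<not> \<mu> > 0"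
      then have "\<mu> = 0" using opnorm_nonneg by (simp add: \<mu>_def order_antisym)
      then have "stretch t (a v0) = 0"
        using opnorm_eq_zero[OF lin_sa] by (simp add: \<mu>_def)
      moreover have "stretch t 0 = 0" by (rule linear_0[OF linear_stretch])
      ultimately have "a v0 = 0"
        using stretch_inverse[OF t] by metis
      with v0 show False ..
    qed
    define i where "i k = int_part (\<lambda>q. real k * c q)" for k :: nat
    have frac: "opnorm (\<lambda>v. real k *\<^sub>R y0 v - i k v) \<le> gen_bound" for k
      using opnorm_frac_part[of "\<lambda>q. real k * c q"] by (simp add: i_def c scaleR_sum_right)
    define d where "d k = (\<lambda>v. (1 / \<mu>) *\<^sub>R stretch t (a (real k *\<^sub>R y0 v - i k v)))" for k
    have "opnorm (d k) \<le> gen_bound" for k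
    proof -
      have "opnorm (\<lambda>v. stretch t (a (real k *\<^sub>R y0 v - i k v))) \<le> \<mu> * opnorm (\<lambda>v. real k *\<^sub>R y0 v - i k v)"
        unfolding \<mu>_def by (rule opnorm_comp_le[OF lin_sa])
      also have "\<dots> \<le> \<mu> * gen_bound" using \<mu> frac by simp
      finally show ?thesis using \<mu> by (simp add: d_def opnorm_scaleR field_simps)
    qed
    then obtain k l where kl: "k < l" "l \<le> N" "opnorm (\<lambda>v. d l v - d k v) < 1"
      using N by blast
    define w where "w = (\<lambda>v. real (l - k) *\<^sub>R z v - a (i l v - i k v))"
    have wR: "W_endo w"
      unfolding w_def i_def
      by (rule W_endo_diff[OF W_endo_scaleR[OF z] W_endo_comp[OF aR W_endo_diff[OF W_endo_int_part W_endo_int_part]]]) simp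
    have "d l v - d k v = (1 / \<mu>) *\<^sub>R stretch t (w v)" for v
    proof -
      have "(real l *\<^sub>R y0 v - i l v) - (real k *\<^sub>R y0 v - i k v) = real (l - k) *\<^sub>R y0 v - (i l v - i k v)"
        using kl(1) by (simp add: of_nat_diff scaleR_diff_left)
      then have "w v = a ((real l *\<^sub>R y0 v - i l v) - (real k *\<^sub>R y0 v - i k v))"
        by (simp only: w_def linear_diff[OF lina] linear_cmul[OF lina] y0(3))
      then show ?thesis
        by (simp only: d_def linear_diff[OF lin_sa] scaleR_diff_right)
    qed
    then have "opnorm (\<lambda>v. stretch t (w v)) < \<mu>"
      using kl(3) \<mu> by (simp add: opnorm_scaleR)
    then have w0: "w v = 0" for v
      using a wR unfolding shortest_def \<mu>_def by (meson not_le)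
    \<comment> \<open>The multiplier \<open>l - k\<close> depends on \<open>z\<close> and \<open>t\<close>; the factorial replaces it by a common one.\<close>
    have "l - k dvd fact N"
      using kl by (intro dvd_fact) auto
    then obtain s where s: "fact N = s * (l - k)" by (metis dvd_def mult.commute)
    have "real (fact N) *\<^sub>R z v = a (real s *\<^sub>R (i l v - i k v))" for v
    proof -
      have "real (l - k) *\<^sub>R z v = a (i l v - i k v)"
        using w0[of v] by (simp add: w_def)
      then have "real s *\<^sub>R (real (l - k) *\<^sub>R z v) = real s *\<^sub>R a (i l v - i k v)" by simp
      then show ?thesis
        using s by (metis linear_cmul[OF lina] of_nat_mult scaleR_scaleR)
    qed
    moreover have "W_endo (\<lambda>v. real s *\<^sub>R (i l v - i k v))"
      unfolding i_def by (intro W_endo_scaleR W_endo_diff W_endo_int_part) simp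
    ultimately show ?thesis by blast
  qed
  show thesis by (rule that[OF _ main]) auto
qed

text \<open>If \<open>a\<close> and \<open>a'\<close> agree modulo \<open>N\<close>, then \<open>a' - a\<close> is \<open>N\<close> times an integral map and hence of the form
\<open>a y\<close>, so that \<open>a' = a (1 + y)\<close>. By symmetry \<open>a = a' (1 + y')\<close>, and cancelling \<open>a\<close> shows that
\<open>1 + y\<close> is a unit. There are finitely many classes modulo \<open>N\<close> and finitely many units.\<close>

lemma finite_shortest:
  assumes fin: "finite {u. lattice_unit u}"
  shows "finite {a. \<exists>t>0. shortest t a}"
proof -
  obtain N :: nat where N: "N > 0" and divides:
    "\<And>t a z. t > 0 \<Longrightarrow> shortest t a \<Longrightarrow> W_endo z \<Longrightarrow> \<exists>y. W_endo y \<and> (\<forall>v. real N *\<^sub>R z v = a (y v))"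
    using shortest_divides by blast
  define T where "T = {a. \<exists>t>0. shortest t a}"
  have T_W_endo: "W_endo a" and T_nz: "\<exists>v. a v \<noteq> 0" if "a \<in> T" for a
    using that by (auto simp: T_def shortest_def)
  have T_div: "\<exists>y. W_endo y \<and> (\<forall>v. real N *\<^sub>R z v = a (y v))" if "a \<in> T" "W_endo z" for a z
    using that divides by (auto simp: T_def)
  define \<kappa> where "\<kappa> a = (\<lambda>q\<in>B \<times> B. \<lfloor>coord (a (fst q)) (snd q)\<rfloor> mod int N)" for a
  have "\<kappa> ` T \<subseteq> (\<Pi>\<^sub>E q\<in>B \<times> B. {0..<int N})"
    using N unfolding \<kappa>_def by (intro image_subsetI) (simp only: restrict_PiE_iff, simp)
  then have fin\<kappa>: "finite (\<kappa> ` T)"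
    by (rule finite_subset) (auto intro!: finite_PiE simp: finite_B)
  have step: "\<exists>y. W_endo y \<and> (\<forall>v. a' v = a (v + y v))"
    if a: "a \<in> T" "a' \<in> T" "\<kappa> a = \<kappa> a'" for a a'
  proof -
    define z where "z = (\<lambda>v. (1 / real N) *\<^sub>R (a' v - a v))"
    have eq: "equivariant z"
      unfolding z_def
      by (rule equivariant_scaleR[OF equivariant_diff[OF W_endo_equivariant[OF T_W_endo] W_endo_equivariant[OF T_W_endo]]])
        (rule a)+
    have zb: "z b \<in> \<Lambda>" if b: "b \<in> B" for b
      unfolding mem_lattice_iff
    proof
      fix b' assume b': "b' \<in> B"
      have "a b \<in> \<Lambda>" "a' b \<in> \<Lambda>"
        using a b by (simp_all add: lattice_endo_mem[OF W_endo_lattice_endo[OF T_W_endo]] basis_in_lattice)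
      then obtain i j where ij: "coord (a b) b' = of_int i" "coord (a' b) b' = of_int j"
        using b' unfolding mem_lattice_iff by (metis Ints_cases)
      then have "i mod int N = j mod int N"
        using fun_cong[OF a(3), of "(b, b')"] b b' by (simp add: \<kappa>_def)
      then have "int N dvd j - i" by (metis mod_eq_dvd_iff)
      then obtain k where "j - i = int N * k" by (auto elim: dvdE)
      then have "of_int j - of_int i = real N * of_int k"
        by (metis of_int_diff of_int_mult of_int_of_nat_eq)
      then show "coord (z b) b' \<in> \<int>"
        using N by (simp add: z_def coord_scaleR coord_diff ij)
    qed
    have "lattice_endo z"
      by (rule lattice_endoI[OF eq]) (rule lattice_expand[OF _ equivariant_linear[OF eq] zb])
    moreover have "z v \<in> W" for v
      unfolding z_def using W_endo_mem[OF T_W_endo[OF a(1)]] W_endo_mem[OF T_W_endo[OF a(2)]]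
      by (simp add: subspace_scale[OF subspace_W] subspace_diff[OF subspace_W])
    ultimately have "W_endo z" by (simp add: W_endo_def)
    then obtain y where y: "W_endo y" "\<And>v. real N *\<^sub>R z v = a (y v)"
      using T_div[OF a(1)] by blast
    have "a' v = a (v + y v)" for v
      using y(2)[of v, symmetric] N by (simp add: z_def linear_add[OF W_endo_linear[OF T_W_endo[OF a(1)]]])
    then show ?thesis using y(1) by blast
  qed
  \<comment> \<open>From \<open>a = a (1 + y') (1 + y)\<close> and injectivity of \<open>a\<close> on \<open>W\<close>, where the difference lies.\<close>
  have cancel: "v + y v + y' (v + y v) = v"
    if a: "a \<in> T" "W_endo y" "W_endo y'" "\<And>v. a' v = a (v + y' v)" "\<And>v. a v = a' (v + y v)" for a a' y y' v
  proof -
    obtain v0 where "a v0 \<noteq> 0" using T_nz[OF a(1)] by blast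
    moreover have "y v + y' (v + y v) \<in> W"
      using W_endo_mem[OF a(2)] W_endo_mem[OF a(3)] by (rule subspace_add[OF subspace_W])
    moreover have "a v = a (v + (y v + y' (v + y v)))"
      using a(4)[of "v + y v"] a(5)[of v] by (simp add: add.assoc)
    then have "a (y v + y' (v + y v)) = 0"
      by (simp add: linear_add[OF W_endo_linear[OF T_W_endo[OF a(1)]], of v])
    ultimately have "y v + y' (v + y v) = 0"
      using W_endo_inj[OF T_W_endo[OF a(1)]] by blast
    then show ?thesis by (simp add: add.assoc)
  qed
  have unit: "\<exists>u. lattice_unit u \<and> a' = (\<lambda>v. a (u v))"
    if a: "a \<in> T" "a' \<in> T" "\<kappa> a = \<kappa> a'" for a a'
  proof -
    obtain y where y: "W_endo y" "\<And>v. a' v = a (v + y v)" using step[OF a] by blast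
    obtain y' where y': "W_endo y'" "\<And>v. a v = a' (v + y' v)"
      using step[OF a(2,1) a(3)[symmetric]] by blast
    have "lattice_unit (\<lambda>v. v + y v)"
      unfolding lattice_unit_def
    proof (intro conjI exI[of _ "\<lambda>v. v + y' v"] allI)
      show "lattice_endo (\<lambda>v. v + y v)" "lattice_endo (\<lambda>v. v + y' v)"
        by (rule lattice_endo_add[OF lattice_endo_ident W_endo_lattice_endo[OF y(1)]],
            rule lattice_endo_add[OF lattice_endo_ident W_endo_lattice_endo[OF y'(1)]])
      show "v + y' v + y (v + y' v) = v" for v
        by (rule cancel[where a = a and a' = a' and y = y' and y' = y, OF a(1) y'(1) y(1) y(2) y'(2)])
      show "v + y v + y' (v + y v) = v" for v
        by (rule cancel[where a = a' and a' = a and y = y and y' = y', OF a(2) y(1) y'(1) y'(2) y(2)])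
    qed
    then show ?thesis using y(2) by blast
  qed
  define rep where "rep k = (SOME a. a \<in> T \<and> \<kappa> a = k)" for k
  have rep: "rep (\<kappa> a) \<in> T \<and> \<kappa> (rep (\<kappa> a)) = \<kappa> a" if "a \<in> T" for a
    unfolding rep_def by (rule someI[of _ a]) (simp add: that)
  have "T \<subseteq> (\<lambda>(k, u). (\<lambda>v. rep k (u v))) ` (\<kappa> ` T \<times> {u. lattice_unit u})"
  proof
    fix a assume a: "a \<in> T"
    obtain u where "lattice_unit u" "a = (\<lambda>v. rep (\<kappa> a) (u v))"
      using unit[of "rep (\<kappa> a)" a] rep[OF a] a by blast
    then show "a \<in> (\<lambda>(k, u). (\<lambda>v. rep k (u v))) ` (\<kappa> ` T \<times> {u. lattice_unit u})"
      using a by (intro image_eqI[of _ _ "(\<kappa> a, u)"]) auto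
  qed
  then have "finite T"
    by (rule finite_subset) (intro finite_imageI finite_cartesian_product fin\<kappa> fin)
  then show ?thesis by (simp add: T_def)
qed

text \<open>Some \<open>a\<close> is shortest for arbitrarily large \<open>t\<close>. The norm of \<open>x\<^sub>t a\<close> grows like \<open>t \<delta>\<close>, with \<open>\<delta>\<close> the norm of
\<open>e a\<close>, whereas that of \<open>x\<^sub>t b\<close> grows at most like \<open>t \<delta> / 2\<close> for the map \<open>b\<close> of \<open>small_e_part\<close>.\<close>

lemma splitting_trivial:
  assumes fin: "finite {u. lattice_unit u}" and e0: "e v1 \<noteq> 0"
  shows "p v = e v"
proof (rule ccontr)
  assume ne: "p v \<noteq> e v"
  have pe: "p (e v1) \<noteq> 0" using e0 p_ident[OF e_in] by simp
  have "\<exists>a. shortest (Suc n) a" for n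
    using ex_shortest[OF zero_less_Suc pe] by blast
  then obtain A where A: "\<And>n. shortest (Suc n) (A n)" by metis
  have "range A \<subseteq> {a. \<exists>t>0. shortest t a}"
    using A by blast
  then have "finite (range A)" using finite_shortest[OF fin] by (rule finite_subset)
  then obtain k where inf: "infinite {n. A n = A k}"
    using pigeonhole_infinite[of UNIV A] infinite_UNIV_nat by auto
  define a where "a = A k"
  have unbounded: "\<exists>n\<ge>n0. shortest (Suc n) a" for n0
  proof -
    obtain n where "A n = A k" "\<not> n \<le> n0"
      using inf unfolding finite_nat_set_iff_bounded_le by blast
    then show ?thesis
      using A[of n] unfolding a_def by (intro exI[of _ n]) simp
  qed
  have aR: "W_endo a" and "\<exists>v. a v \<noteq> 0" using A[of k] by (auto simp: a_def shortest_def)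
  then obtain v0 where v0: "a v0 \<noteq> 0" by blast
  obtain v2 where v2: "a v2 = e v1" using W_endo_range[OF aR v0] e_in by (metis rangeE)
  define \<delta> where "\<delta> = opnorm (\<lambda>v. e (a v))"
  have "linear (\<lambda>v. e (a v))"
    using linear_compose[OF W_endo_linear[OF aR] linear_e] by (simp add: o_def)
  then have "\<delta> \<noteq> 0"
    unfolding \<delta>_def using opnorm_eq_zero[of "\<lambda>v. e (a v)" v2] v2 e0 e_idem by auto
  then have "\<delta> > 0" using opnorm_nonneg by (simp add: \<delta>_def less_le)
  then have "\<delta> / 2 > 0" by simp
  obtain b v3 where b: "W_endo b" "b v3 \<noteq> 0" "opnorm (\<lambda>v. e (b v)) < \<delta> / 2"
    by (rule small_e_part[OF ne \<open>\<delta> / 2 > 0\<close>])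
  define C where "C = opnorm (\<lambda>v. a v - e (a v)) + opnorm (\<lambda>v. b v - e (b v))"
  have bound: "real t * (\<delta> / 2) \<le> C" if t: "shortest t a" for t
  proof -
    have "(\<lambda>v. real t *\<^sub>R e (a v)) = (\<lambda>v. stretch t (a v) - (a v - e (a v)))"
      by (simp add: stretch_def)
    then have "real t * \<delta> \<le> opnorm (\<lambda>v. stretch t (a v)) + opnorm (\<lambda>v. a v - e (a v))"
      using opnorm_triangle_diff[of "\<lambda>v. stretch t (a v)" "\<lambda>v. a v - e (a v)"]
        opnorm_scaleR[of "real t" "\<lambda>v. e (a v)"] by (simp add: \<delta>_def)
    also have "opnorm (\<lambda>v. stretch t (a v)) \<le> opnorm (\<lambda>v. stretch t (b v))"
      using t b(1,2) by (auto simp: shortest_def)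
    also have "opnorm (\<lambda>v. stretch t (b v)) \<le> real t * opnorm (\<lambda>v. e (b v)) + opnorm (\<lambda>v. b v - e (b v))"
      using opnorm_triangle[of "\<lambda>v. real t *\<^sub>R e (b v)" "\<lambda>v. b v - e (b v)"]
        opnorm_scaleR[of "real t" "\<lambda>v. e (b v)"] by (simp add: stretch_def)
    also have "real t * opnorm (\<lambda>v. e (b v)) \<le> real t * (\<delta> / 2)"
      using b(3) by (intro mult_left_mono) auto
    finally show ?thesis by (simp add: C_def field_simps)
  qed
  obtain n0 :: nat where n0: "C < real n0 * (\<delta> / 2)"
    using reals_Archimedean3[OF \<open>\<delta> / 2 > 0\<close>] by blast
  obtain n where n: "n \<ge> n0" "shortest (Suc n) a" using unbounded by blast
  have "real n0 * (\<delta> / 2) \<le> real (Suc n) * (\<delta> / 2)"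
    using n(1) \<open>\<delta> / 2 > 0\<close> by (intro mult_right_mono) auto
  with bound[OF n(2)] n0 show False by linarith
qed

end

section \<open>Finitely many units: rationality and pairwise non-isomorphism\<close>

locale lattice_decomposition = lattice_group +
  fixes U :: "nat \<Rightarrow> 'a set" and r :: nat
  assumes direct: "internal_direct_sum r U"
    and irreducible: "\<And>i. i \<in> {1..r} \<Longrightarrow> irreducible_subspace G (U i)"
begin

lemma subspace_U: "i \<in> {1..r} \<Longrightarrow> subspace (U i)"
  using direct by (simp add: internal_direct_sum_def)

lemma G_U: "i \<in> {1..r} \<Longrightarrow> g \<in> G \<Longrightarrow> u \<in> U i \<Longrightarrow> g u \<in> U i"
  using irreducible[of i] by (auto simp: irreducible_subspace_def invariant_subspace_def)

lemma invariant_U: "i \<in> {1..r} \<Longrightarrow> invariant_subspace G (U i)"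
  using irreducible[of i] by (simp add: irreducible_subspace_def)

lemma U_nonzero: "i \<in> {1..r} \<Longrightarrow> \<exists>u\<in>U i. u \<noteq> 0"
  using irreducible[of i] subspace_0[OF subspace_U, of i]
  by (auto simp: irreducible_subspace_def)

lemma U_simple: "i \<in> {1..r} \<Longrightarrow> invariant_subspace G X \<Longrightarrow> X \<subseteq> U i \<Longrightarrow> X = {0} \<or> X = U i"
  using irreducible[of i] by (simp add: irreducible_subspace_def)

definition proj :: "nat \<Rightarrow> 'a \<Rightarrow> 'a" where
  "proj i v = (THE u. u \<in> (\<Pi>\<^sub>E i\<in>{1..r}. U i) \<and> v = (\<Sum>i=1..r. u i)) i"

lemma proj_props: "(\<lambda>i\<in>{1..r}. proj i v) \<in> (\<Pi>\<^sub>E i\<in>{1..r}. U i) \<and> v = (\<Sum>i=1..r. proj i v)"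
proof -
  define u where "u = (THE u. u \<in> (\<Pi>\<^sub>E i\<in>{1..r}. U i) \<and> v = (\<Sum>i=1..r. u i))"
  have "\<exists>!u. u \<in> (\<Pi>\<^sub>E i\<in>{1..r}. U i) \<and> v = (\<Sum>i=1..r. u i)"
    using direct by (simp add: internal_direct_sum_def)
  from theI'[OF this] have u: "u \<in> (\<Pi>\<^sub>E i\<in>{1..r}. U i)" "v = (\<Sum>i=1..r. u i)"
    unfolding u_def by simp_all
  have eq: "proj i v = u i" for i by (simp add: proj_def u_def)
  show ?thesis
    unfolding eq PiE_restrict[OF u(1)] using u by (rule conjI)
qed

lemma proj_in: "i \<in> {1..r} \<Longrightarrow> proj i v \<in> U i"
  using proj_props[of v] by (auto simp: PiE_iff)

lemma sum_proj: "(\<Sum>i=1..r. proj i v) = v"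
  using proj_props[of v] by simp

lemma proj_unique:
  assumes "\<And>i. i \<in> {1..r} \<Longrightarrow> x i \<in> U i" "v = (\<Sum>i=1..r. x i)" "i \<in> {1..r}"
  shows "proj i v = x i"
proof -
  have ex1: "\<exists>!u. u \<in> (\<Pi>\<^sub>E i\<in>{1..r}. U i) \<and> v = (\<Sum>i=1..r. u i)"
    using direct by (simp add: internal_direct_sum_def)
  have "restrict x {1..r} \<in> (\<Pi>\<^sub>E i\<in>{1..r}. U i) \<and> v = (\<Sum>i=1..r. restrict x {1..r} i)"
    using assms(1,2) by (simp add: restrict_PiE_iff)
  moreover have "(\<lambda>i\<in>{1..r}. proj i v) \<in> (\<Pi>\<^sub>E i\<in>{1..r}. U i) \<and> v = (\<Sum>i=1..r. (\<lambda>i\<in>{1..r}. proj i v) i)"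
    using proj_props[of v] by simp
  ultimately have "restrict x {1..r} = (\<lambda>i\<in>{1..r}. proj i v)"
    using ex1 by blast
  from fun_cong[OF this, of i] assms(3) show ?thesis by simp
qed

lemma proj_linear: "i \<in> {1..r} \<Longrightarrow> linear (proj i)"
proof (rule linearI)
  fix v w assume i: "i \<in> {1..r}"
  have "proj i (v + w) = (\<lambda>i. proj i v + proj i w) i"
    by (rule proj_unique[OF _ _ i]) (simp_all add: subspace_add subspace_U proj_in sum.distrib sum_proj[simplified])
  then show "proj i (v + w) = proj i v + proj i w" .
next
  fix c v assume i: "i \<in> {1..r}"
  have "proj i (c *\<^sub>R v) = (\<lambda>i. c *\<^sub>R proj i v) i"
    by (rule proj_unique[OF _ _ i])
      (simp_all add: subspace_scale subspace_U proj_in scaleR_sum_right[symmetric] sum_proj[simplified])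
  then show "proj i (c *\<^sub>R v) = c *\<^sub>R proj i v" .
qed

lemma proj_equivariant: "i \<in> {1..r} \<Longrightarrow> equivariant (proj i)"
  unfolding equivariant_def
proof (intro conjI ballI allI proj_linear)
  fix g v assume i: "i \<in> {1..r}" and g: "g \<in> G"
  have "proj i (g v) = (\<lambda>i. g (proj i v)) i"
    by (rule proj_unique[OF _ _ i])
      (simp_all add: G_U[OF _ g] proj_in linear_sum[OF G_linear[OF g], symmetric] sum_proj[simplified])
  then show "proj i (g v) = g (proj i v)" .
qed

lemma proj_U:
  assumes "i \<in> {1..r}" "j \<in> {1..r}" "u \<in> U j"
  shows "proj i u = (if i = j then u else 0)"
proof -
  have "proj i u = (\<lambda>i. if i = j then u else 0) i"
    by (rule proj_unique[OF _ _ assms(1)])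
      (use assms in \<open>simp_all add: subspace_0 subspace_U sum.delta\<close>)
  then show ?thesis .
qed

lemma proj_idem: "i \<in> {1..r} \<Longrightarrow> proj i (proj i v) = proj i v"
  using proj_U[of i i "proj i v"] proj_in by simp

lemma linear_eq_on_U:
  assumes "linear f" "linear h" "\<And>i u. i \<in> {1..r} \<Longrightarrow> u \<in> U i \<Longrightarrow> f u = h u"
  shows "f v = h v"
proof -
  have "f (\<Sum>i=1..r. proj i v) = h (\<Sum>i=1..r. proj i v)"
    by (simp only: linear_sum[OF assms(1)] linear_sum[OF assms(2)])
      (rule sum.cong[OF refl], rule assms(3)[OF _ proj_in], assumption+)
  then show ?thesis by (simp only: sum_proj)
qed

text \<open>A central projection commutes with \<open>proj i\<close>, so it maps \<open>U i\<close> into itself, and irreducibility leaves only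
two possibilities for the image.\<close>

lemma central_projection_on_U:
  assumes p: "equivariant p" "projection_onto p W" "\<And>a v. equivariant a \<Longrightarrow> p (a v) = a (p v)"
    and i: "i \<in> {1..r}"
  shows "U i \<subseteq> W \<or> (\<forall>u\<in>U i. p u = 0)"
proof -
  have "p u \<in> U i" if "u \<in> U i" for u
  proof -
    have "p u = p (proj i u)" using proj_U[OF i i that] by simp
    also have "\<dots> = proj i (p u)" by (rule p(3)[OF proj_equivariant[OF i]])
    finally show ?thesis using proj_in[OF i] by metis
  qed
  then have "p ` U i \<subseteq> U i" by blast
  then consider "p ` U i = {0}" | "p ` U i = U i"
    using U_simple[OF i equivariant_image_invariant[OF p(1) invariant_U[OF i]]] by blast
  then show ?thesis
  proof cases
    case 1
    then show ?thesis by blast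
  next
    case 2
    have "U i \<subseteq> W"
    proof
      fix u assume "u \<in> U i"
      then obtain u' where "u = p u'" using 2 by blast
      then show "u \<in> W" using p(2) by (simp add: projection_onto_def)
    qed
    then show ?thesis ..
  qed
qed

text \<open>By \<open>projections_eq_of_support\<close> this set determines a subspace that has a central projection; its
cardinality serves as a measure of size.\<close>

definition support :: "'a set \<Rightarrow> nat set" where
  "support W = {i \<in> {1..r}. U i \<subseteq> W}"

lemma finite_support: "finite (support W)"
  by (simp add: support_def)

lemma projections_eq_of_support:
  assumes p: "equivariant p" "projection_onto p W" "\<And>a v. equivariant a \<Longrightarrow> p (a v) = a (p v)"
    and q: "equivariant q" "projection_onto q X" "\<And>a v. equivariant a \<Longrightarrow> q (a v) = a (q v)"
    and eq: "support W = support X"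
  shows "W = X"
proof -
  have "p v = q v" for v
  proof (rule linear_eq_on_U[OF equivariant_linear[OF p(1)] equivariant_linear[OF q(1)]])
    fix i u assume i: "i \<in> {1..r}" and u: "u \<in> U i"
    have iff: "U i \<subseteq> W \<longleftrightarrow> U i \<subseteq> X"
      using eq i by (auto simp: support_def)
    show "p u = q u"
    proof (cases "U i \<subseteq> W")
      case True
      then show ?thesis
        using u iff p(2) q(2) unfolding projection_onto_def by (metis subsetD)
    next
      case False
      then show ?thesis
        using u iff central_projection_on_U[OF p i] central_projection_on_U[OF q i] by simp
    qed
  qed
  then show ?thesis
    using p(2) q(2) unfolding projection_onto_def by (metis subsetI subset_antisym)
qed

text \<open>Let \<open>W\<close> be a rational invariant subspace containing \<open>U i\<close> with the fewest summands. For every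
rational invariant subspace \<open>X\<close> of \<open>W\<close>, either \<open>X\<close> or its complement in \<open>W\<close> contains \<open>U i\<close> and is therefore
all of \<open>W\<close>. So \<open>W\<close> is minimal and \<open>splitting_trivial\<close> applies to \<open>proj i\<close>.\<close>

lemma rational_simple:
  assumes fin: "finite {a. lattice_unit a}" and i: "i \<in> {1..r}"
  shows "rational_subspace \<Lambda> (U i)"
proof -
  have "rational_invariant (range (\<lambda>v. v))"
    by (rule rational_invariant_range[OF lattice_endo_ident])
  then have "rational_invariant UNIV \<and> U i \<subseteq> UNIV" by simp
  from ex_has_least_nat[of "\<lambda>W. rational_invariant W \<and> U i \<subseteq> W", OF this, of "\<lambda>W. card (support W)"]
  obtain W where W: "rational_invariant W" "U i \<subseteq> W"
    and min: "\<And>X. rational_invariant X \<Longrightarrow> U i \<subseteq> X \<Longrightarrow> card (support W) \<le> card (support X)"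
    by blast
  have shrink: "X = W" if X: "rational_invariant X" "U i \<subseteq> X" "X \<subseteq> W" for X
  proof -
    obtain p m where p: "equivariant p" "projection_onto p W" "m > (0::nat)" "lattice_endo (\<lambda>v. real m *\<^sub>R p v)"
      by (rule rational_invariant_projection[OF W(1)])
    obtain q n where q: "equivariant q" "projection_onto q X" "n > (0::nat)" "lattice_endo (\<lambda>v. real n *\<^sub>R q v)"
      by (rule rational_invariant_projection[OF X(1)])
    have "support X \<subseteq> support W" using X(3) by (auto simp: support_def)
    then have "support X = support W"
      using min[OF X(1,2)] by (intro card_seteq finite_support)
    then show ?thesis
      using projections_eq_of_support[OF q(1,2) _ p(1,2)] projection_central[OF fin q] projection_central[OF fin p]
      by blast
  qed
  obtain p m where p: "equivariant p" "projection_onto p W" "m > (0::nat)" "lattice_endo (\<lambda>v. real m *\<^sub>R p v)"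
    by (rule rational_invariant_projection[OF W(1)])
  have pW: "\<And>w. w \<in> W \<Longrightarrow> p w = w" and pin: "\<And>v. p v \<in> W"
    using p(2) by (simp_all add: projection_onto_def)
  interpret rational_splitting B G W p "proj i" m
  proof
    show "equivariant p" "projection_onto p W" "m > 0" "lattice_endo (\<lambda>v. real m *\<^sub>R p v)"
      by (fact p)+
    show "p (a v) = a (p v)" if "equivariant a" for a v
      by (rule projection_central[OF fin p that])
    show "equivariant (proj i)" by (rule proj_equivariant[OF i])
    show "proj i (proj i v) = proj i v" for v by (rule proj_idem[OF i])
    show "proj i v \<in> W" for v using proj_in[OF i] W(2) by blast
    fix a v assume a: "lattice_endo a" "\<And>w. a w \<in> W" "a v \<noteq> 0"
    define X where "X = range a"
    have X: "rational_invariant X" unfolding X_def by (rule rational_invariant_range[OF a(1)])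
    have XW: "X \<subseteq> W" using a(2) by (auto simp: X_def)
    have "X = W"
    proof (cases "U i \<subseteq> X")
      case True
      then show ?thesis by (rule shrink[OF X _ XW])
    next
      case False
      obtain q n where q: "equivariant q" "projection_onto q X" "n > (0::nat)" "lattice_endo (\<lambda>v. real n *\<^sub>R q v)"
        by (rule rational_invariant_projection[OF X])
      note q_central = projection_central[OF fin q]
      have qU: "q u = 0" if "u \<in> U i" for u
        using central_projection_on_U[OF q(1,2) _ i] q_central False that by blast
      \<comment> \<open>If \<open>U i\<close> is not contained in \<open>X\<close>, then \<open>q\<close> kills \<open>U i\<close>, so \<open>U i\<close> lies in the complement of \<open>X\<close> in \<open>W\<close>,
        which is the image of the integral map \<open>h = n m (p - q)\<close>.\<close>
      define h where "h = (\<lambda>v. real n *\<^sub>R (real m *\<^sub>R p v) - real m *\<^sub>R (real n *\<^sub>R q v))"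
      have h: "lattice_endo h"
        unfolding h_def
        by (rule lattice_endo_diff[OF lattice_endo_scaleR[OF p(4)] lattice_endo_scaleR[OF q(4)]]) simp_all
      have h_eq: "h v = (real n * real m) *\<^sub>R (p v - q v)" for v
        by (simp add: h_def scaleR_diff_right mult.commute)
      have nm: "real n * real m \<noteq> 0" using p(3) q(3) by simp
      have "range h = W"
      proof (rule shrink[OF rational_invariant_range[OF h]])
        show "U i \<subseteq> range h"
        proof
          fix u assume u: "u \<in> U i"
          then have "h ((1 / (real n * real m)) *\<^sub>R u) = u"
            using W(2) pW[of u] qU[OF u] nm
            by (auto simp: h_eq linear_cmul[OF equivariant_linear[OF p(1)]] linear_cmul[OF equivariant_linear[OF q(1)]])
          then show "u \<in> range h" by (metis rangeI)
        qed
        have "subspace W"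
          using W(1) by (simp add: rational_invariant_def invariant_subspace_def)
        moreover have "q v \<in> W" for v
          using q(2) XW by (auto simp: projection_onto_def)
        ultimately show "range h \<subseteq> W"
          using pin by (auto simp: h_eq intro!: subspace_scale subspace_diff)
      qed
      moreover have "q (h v) = 0" for v
      proof -
        have "q (p v) = q v"
          using q_central[OF p(1), of v] pW XW q(2) unfolding projection_onto_def by (metis subsetD)
        moreover have "q (q v) = q v" using q(2) by (simp add: projection_onto_def)
        ultimately show ?thesis
          by (simp add: h_eq linear_cmul[OF equivariant_linear[OF q(1)]] linear_diff[OF equivariant_linear[OF q(1)]])
      qed
      ultimately have "q w = 0" if "w \<in> W" for w using that by (metis rangeE)
      moreover have "q (a v) = a v" using q(2) by (simp add: projection_onto_def X_def)
      ultimately show ?thesis using a(2,3) by metis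
    qed
    then show "range a = W" by (simp add: X_def)
  qed
  obtain u where u: "u \<in> U i" "u \<noteq> 0" using U_nonzero[OF i] by blast
  then have "proj i u \<noteq> 0" using proj_U[OF i i] by simp
  then have "p v = proj i v" for v by (rule splitting_trivial[OF fin])
  then have "W \<subseteq> U i" using pW proj_in[OF i] by (metis subsetI)
  then have "W = U i" using W(2) by blast
  then show ?thesis using W(1) by (simp add: rational_invariant_def)
qed

text \<open>An isomorphism, extended by zero to the other summands, is an equivariant map \<open>n\<close> with \<open>p n = n\<close> and
\<open>n p = 0\<close> for the central projection \<open>p\<close> onto \<open>U j\<close>.\<close>

lemma non_isomorphic:
  assumes fin: "finite {a. lattice_unit a}" and i: "i \<in> {1..r}" and j: "j \<in> {1..r}" and "i \<noteq> j"
  shows "\<not> isomorphic_submodules G (U i) (U j)"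
proof
  assume "isomorphic_submodules G (U i) (U j)"
  then obtain f where f: "bij_betw f (U i) (U j)" "\<And>x y. x \<in> U i \<Longrightarrow> y \<in> U i \<Longrightarrow> f (x + y) = f x + f y"
    "\<And>a x. x \<in> U i \<Longrightarrow> f (a *\<^sub>R x) = a *\<^sub>R f x" "\<And>g x. g \<in> G \<Longrightarrow> x \<in> U i \<Longrightarrow> f (g x) = g (f x)"
    unfolding isomorphic_submodules_def by blast
  define n where "n = (\<lambda>v. f (proj i v))"
  have "linear n"
    by (rule linearI)
      (simp_all add: n_def linear_add[OF proj_linear[OF i]] linear_cmul[OF proj_linear[OF i]] f proj_in[OF i])
  then have n: "equivariant n"
    by (simp add: equivariant_def n_def equivariant_commute[OF proj_equivariant[OF i]] f(4) proj_in[OF i])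
  have n_in: "n v \<in> U j" for v
    using f(1) proj_in[OF i] by (auto simp: n_def bij_betw_def)
  have rat: "rational_invariant (U j)"
    using rational_simple[OF fin j] invariant_U[OF j] by (simp add: rational_invariant_def)
  obtain p m where p: "equivariant p" "projection_onto p (U j)" "m > (0::nat)" "lattice_endo (\<lambda>v. real m *\<^sub>R p v)"
    by (rule rational_invariant_projection[OF rat])
  have "n v = n (p v)" for v
    using projection_central[OF fin p n, of v] p(2) n_in by (simp add: projection_onto_def)
  moreover have "n (p v) = 0" for v
  proof -
    have "proj i (p v) = 0"
      using proj_U[OF i j, of "p v"] p(2) \<open>i \<noteq> j\<close> by (simp add: projection_onto_def)
    then have "n (p v) = n 0" by (simp add: n_def linear_0[OF proj_linear[OF i]])
    then show ?thesis by (simp add: linear_0[OF \<open>linear n\<close>])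
  qed
  ultimately have n0: "n v = 0" for v by metis
  obtain u where u: "u \<in> U i" "u \<noteq> 0" using U_nonzero[OF i] by blast
  have "f u = n u" "f 0 = n 0"
    using u proj_U[OF i i] by (simp_all add: n_def linear_0[OF proj_linear[OF i]])
  then have "f u = f 0" using n0 by simp
  then show False
    using f(1) u subspace_0[OF subspace_U[OF i]] by (auto simp: bij_betw_def inj_on_def)
qed

end

section \<open>Rational non-isomorphic summands: finitely many units\<close>

lemma convergent_subsequence_finite:
  fixes h :: "nat \<Rightarrow> 'k \<Rightarrow> real"
  assumes "finite K" "\<And>n q. q \<in> K \<Longrightarrow> \<bar>h n q\<bar> \<le> c"
  shows "\<exists>\<rho> l. strict_mono (\<rho> :: nat \<Rightarrow> nat) \<and> (\<forall>q\<in>K. (\<lambda>n. h (\<rho> n) q) \<longlonglongrightarrow> l q)"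
  using assms
proof (induction K)
  case empty
  then show ?case by (intro exI[of _ id]) (simp add: strict_mono_def)
next
  case (insert x F)
  then obtain \<rho> l where \<rho>: "strict_mono \<rho>" and l: "\<forall>q\<in>F. (\<lambda>n. h (\<rho> n) q) \<longlonglongrightarrow> l q"
    by blast
  have "bounded (range (\<lambda>n. h (\<rho> n) x))"
    unfolding bounded_iff using insert.prems by (intro exI[of _ c]) auto
  then obtain l' \<sigma> where \<sigma>: "strict_mono \<sigma>" and l': "((\<lambda>n. h (\<rho> n) x) \<circ> \<sigma>) \<longlonglongrightarrow> l'"
    using bounded_imp_convergent_subsequence by blast
  have "(\<lambda>n. h ((\<rho> \<circ> \<sigma>) n) q) \<longlonglongrightarrow> (l(x := l')) q" if "q \<in> insert x F" for q
  proof (cases "q = x")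
    case True
    then show ?thesis using l' by (simp add: o_def)
  next
    case False
    then have "(\<lambda>n. h (\<rho> n) q) \<longlonglongrightarrow> l q" using that l by simp
    from LIMSEQ_subseq_LIMSEQ[OF this \<sigma>] show ?thesis using False by (simp add: o_def)
  qed
  then show ?case
    using strict_mono_o[OF \<rho> \<sigma>] by blast
qed

context lattice_basis begin

text \<open>Bolzano-Weierstrass for linear maps, entry by entry. The limit is expressed through the operator norm, as
the vector space itself carries no topology.\<close>

lemma opnorm_limit_point:
  fixes d :: "nat \<Rightarrow> 'v \<Rightarrow> 'v"
  assumes lin: "\<And>n. linear (d n)" and bd: "\<And>n. opnorm (d n) \<le> c"
  obtains d' where "linear d'" "\<And>\<epsilon> n0. \<epsilon> > 0 \<Longrightarrow> \<exists>n\<ge>n0. opnorm (\<lambda>v. d n v - d' v) < \<epsilon>"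
proof -
  have coord_bd: "\<bar>coord (d n (fst q)) (snd q)\<bar> \<le> c" if q: "q \<in> B \<times> B" for n q
  proof -
    have "\<bar>coord (d n (fst q)) (snd q)\<bar> \<le> vnorm (d n (fst q))"
      using q by (intro abs_coord_le_vnorm) auto
    also have "\<dots> \<le> opnorm (d n)"
      unfolding opnorm_def using q by (intro member_le_sum) (auto simp: vnorm_nonneg finite_B)
    finally show ?thesis using bd[of n] by simp
  qed
  obtain \<rho> l where \<rho>: "strict_mono (\<rho> :: nat \<Rightarrow> nat)"
    and l: "\<And>q. q \<in> B \<times> B \<Longrightarrow> (\<lambda>n. coord (d (\<rho> n) (fst q)) (snd q)) \<longlonglongrightarrow> l q"
    using convergent_subsequence_finite[of "B \<times> B" "\<lambda>n q. coord (d n (fst q)) (snd q)" c,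
        OF finite_cartesian_product[OF finite_B finite_B] coord_bd]
    by blast
  define d' where "d' v = (\<Sum>b\<in>B. coord v b *\<^sub>R (\<Sum>b'\<in>B. l (b, b') *\<^sub>R b'))" for v
  have "linear d'"
    unfolding d'_def[abs_def] by (rule linear_compose_sum) (simp add: linear_coord)
  have coord_d': "coord (d' b) b' = l (b, b')" if "b \<in> B" "b' \<in> B" for b b'
  proof -
    have "d' b = (\<Sum>b'\<in>B. l (b, b') *\<^sub>R b')"
      using that(1) by (simp add: d'_def coord_basis if_distrib[of "\<lambda>x. x *\<^sub>R _"] sum.delta finite_B cong: if_cong)
    then show ?thesis
      using that(2) by (simp add: coord_sum coord_scaleR coord_basis if_distrib[of "\<lambda>x. _ * x"] sum.delta finite_B cong: if_cong)
  qed
  have "(\<lambda>n. opnorm (\<lambda>v. d (\<rho> n) v - d' v)) \<longlonglongrightarrow> (\<Sum>b\<in>B. \<Sum>b'\<in>B. \<bar>l (b, b') - coord (d' b) b'\<bar>)"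
    unfolding opnorm_def vnorm_def coord_diff
    by (intro tendsto_sum tendsto_rabs tendsto_diff tendsto_const) (use l in force)
  also have "(\<Sum>b\<in>B. \<Sum>b'\<in>B. \<bar>l (b, b') - coord (d' b) b'\<bar>) = 0"
    by (simp add: coord_d')
  finally have lim: "(\<lambda>n. opnorm (\<lambda>v. d (\<rho> n) v - d' v)) \<longlonglongrightarrow> 0" .
  have "\<exists>n\<ge>n0. opnorm (\<lambda>v. d n v - d' v) < \<epsilon>" if "\<epsilon> > 0" for \<epsilon> n0
  proof -
    obtain n1 where n1: "\<And>n. n \<ge> n1 \<Longrightarrow> opnorm (\<lambda>v. d (\<rho> n) v - d' v) < \<epsilon>"
      using order_tendstoD(2)[OF lim \<open>\<epsilon> > 0\<close>] by (auto simp: eventually_sequentially)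
    have "n0 \<le> \<rho> (max n0 n1)"
      using seq_suble[OF \<rho>, of "max n0 n1"] by simp
    then show ?thesis using n1[of "max n0 n1"] by auto
  qed
  with \<open>linear d'\<close> show thesis using that by blast
qed

text \<open>Linear relations between values pass to limit points. Used for equivariance of the limit and for its
invariance under \<open>proj i\<close> on either side.\<close>

lemma limit_point_relation:
  fixes d :: "nat \<Rightarrow> 'v \<Rightarrow> 'v" and d' a a' :: "'v \<Rightarrow> 'v"
  assumes lim: "\<And>\<epsilon>. \<epsilon> > 0 \<Longrightarrow> \<exists>n. opnorm (\<lambda>v. d n v - d' v) < \<epsilon>"
    and lin: "\<And>n. linear (d n)" "linear d'" "linear a" "linear a'"
    and rel: "\<And>n. a (d n v) = a' (d n w)"
  shows "a (d' v) = a' (d' w)"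
proof -
  define C where "C = opnorm a * vnorm v + opnorm a' * vnorm w + 1"
  have expand: "opnorm a' * (t * vnorm w) + opnorm a * (t * vnorm v) = t * (C - 1)" for t
    by (simp add: C_def algebra_simps)
  have C: "C > 0"
    unfolding C_def using opnorm_nonneg vnorm_nonneg by (simp add: add_nonneg_pos)
  have "vnorm (a (d' v) - a' (d' w)) \<le> \<epsilon>" if \<epsilon>: "\<epsilon> > 0" for \<epsilon>
  proof -
    obtain n where n: "opnorm (\<lambda>v. d n v - d' v) < \<epsilon> / C"
      using lim[of "\<epsilon> / C"] C \<epsilon> by auto
    have lind: "linear (\<lambda>v. d n v - d' v)"
      by (rule linear_compose_sub[OF lin(1,2)])
    have le: "vnorm (f (d n x - d' x)) \<le> opnorm f * ((\<epsilon> / C) * vnorm x)" if "linear f" for f x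
    proof -
      have "vnorm (f (d n x - d' x)) \<le> opnorm f * vnorm (d n x - d' x)"
        by (rule vnorm_apply_le[OF that])
      also have "\<dots> \<le> opnorm f * (opnorm (\<lambda>v. d n v - d' v) * vnorm x)"
        by (rule mult_left_mono[OF vnorm_apply_le[OF lind] opnorm_nonneg])
      also have "\<dots> \<le> opnorm f * ((\<epsilon> / C) * vnorm x)"
        using n by (intro mult_left_mono mult_right_mono opnorm_nonneg vnorm_nonneg) simp
      finally show ?thesis .
    qed
    have "a (d' v) - a' (d' w) = a' (d n w - d' w) - a (d n v - d' v)"
      by (simp add: linear_diff[OF lin(3)] linear_diff[OF lin(4)] rel)
    then have "vnorm (a (d' v) - a' (d' w)) \<le> opnorm a' * ((\<epsilon> / C) * vnorm w) + opnorm a * ((\<epsilon> / C) * vnorm v)"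
      using order_trans[OF vnorm_triangle_diff add_mono[OF le[OF lin(4)] le[OF lin(3)]]] by simp
    also have "\<dots> = (\<epsilon> / C) * (C - 1)"
      by (rule expand)
    also have "\<dots> \<le> \<epsilon>"
      using C \<epsilon> by (simp add: field_simps)
    finally show ?thesis .
  qed
  then have "vnorm (a (d' v) - a' (d' w)) \<le> 0"
    by - (rule field_le_epsilon, simp)
  then have "vnorm (a (d' v) - a' (d' w)) = 0"
    using vnorm_nonneg by (rule order_antisym)
  from vnorm_eq_zero[OF this] show ?thesis by simp
qed

end

context lattice_decomposition begin

lemma schur:
  assumes a: "equivariant a" and ij: "i \<in> {1..r}" "j \<in> {1..r}"
    and maps: "\<And>u. u \<in> U i \<Longrightarrow> a u \<in> U j" and nz: "u0 \<in> U i" "a u0 \<noteq> 0"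
  shows "bij_betw a (U i) (U j)"
proof -
  note lin = equivariant_linear[OF a]
  define K where "K = {u \<in> U i. a u = 0}"
  have "subspace K"
    using subspace_U[OF ij(1)] unfolding K_def subspace_def
    by (simp add: linear_0[OF lin] linear_add[OF lin] linear_cmul[OF lin])
  then have "invariant_subspace G K"
    using G_U[OF ij(1)]
    by (auto simp: invariant_subspace_def K_def equivariant_commute[OF a] linear_0[OF G_linear])
  then have "K = {0} \<or> K = U i"
    by (rule U_simple[OF ij(1)]) (auto simp: K_def)
  then have K: "K = {0}" using nz by (auto simp: K_def)
  have "inj_on a (U i)"
  proof (rule inj_onI)
    fix x y assume "x \<in> U i" "y \<in> U i" "a x = a y"
    then have "x - y \<in> K"
      by (simp add: K_def linear_diff[OF lin] subspace_diff[OF subspace_U[OF ij(1)]])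
    then show "x = y" using K by simp
  qed
  moreover have "a ` U i = {0} \<or> a ` U i = U j"
    by (rule U_simple[OF ij(2) equivariant_image_invariant[OF a invariant_U[OF ij(1)]]])
      (use maps in blast)
  then have "a ` U i = U j" using nz by blast
  ultimately show ?thesis by (simp add: bij_betw_def)
qed

text \<open>By Schur's lemma a nonzero component of \<open>c\<close> from \<open>U i\<close> to another summand \<open>U j\<close> would be an isomorphism.\<close>

lemma maps_U_to_U:
  assumes noniso: "\<And>i j. i \<in> {1..r} \<Longrightarrow> j \<in> {1..r} \<Longrightarrow> i \<noteq> j \<Longrightarrow> \<not> isomorphic_submodules G (U i) (U j)"
    and c: "equivariant c" and i: "i \<in> {1..r}" and u: "u \<in> U i"
  shows "c u \<in> U i"
proof -
  have zero: "proj j (c u) = 0" if j: "j \<in> {1..r}" "j \<noteq> i" for j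
  proof (rule ccontr)
    assume nz: "proj j (c u) \<noteq> 0"
    define a where "a = (\<lambda>v. proj j (c v))"
    have a: "equivariant a" unfolding a_def by (rule equivariant_comp[OF proj_equivariant[OF j(1)] c])
    have "bij_betw a (U i) (U j)"
      by (rule schur[OF a i j(1) _ u]) (simp_all add: a_def proj_in[OF j(1)] nz)
    then have "isomorphic_submodules G (U i) (U j)"
      unfolding isomorphic_submodules_def
      by (intro exI[of _ a])
        (simp add: linear_add[OF equivariant_linear[OF a]] linear_cmul[OF equivariant_linear[OF a]]
          equivariant_commute[OF a])
    then show False using noniso[OF i j(1)] j(2) by blast
  qed
  have "c u = (\<Sum>j=1..r. proj j (c u))" by (simp only: sum_proj)
  also have "\<dots> = (\<Sum>j=1..r. if j = i then proj i (c u) else 0)"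
    by (rule sum.cong[OF refl]) (auto simp: zero)
  also have "\<dots> = proj i (c u)" using i by (simp add: sum.delta)
  finally show ?thesis using proj_in[OF i] by metis
qed

text \<open>The rational bases of the summands together span \<open>V\<close>, and \<open>proj i\<close> fixes or kills each of their elements.\<close>

lemma integral_proj:
  assumes rat: "\<And>i. i \<in> {1..r} \<Longrightarrow> rational_subspace \<Lambda> (U i)" and i: "i \<in> {1..r}"
  obtains m :: nat where "m > 0" "lattice_endo (\<lambda>v. real m *\<^sub>R proj i v)"
proof -
  have "\<forall>j\<in>{1..r}. \<exists>C. C \<subseteq> U j \<inter> \<Lambda> \<and> span C = U j"
    using rat unfolding rational_subspace_def by blast
  then obtain C where C: "\<And>j. j \<in> {1..r} \<Longrightarrow> C j \<subseteq> U j \<inter> \<Lambda>" "\<And>j. j \<in> {1..r} \<Longrightarrow> span (C j) = U j"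
    by metis
  define D where "D = (\<Union>j\<in>{1..r}. C j)"
  have "D \<subseteq> \<Lambda>" using C(1) unfolding D_def by blast
  have "v \<in> span D" for v
  proof -
    have "proj j v \<in> span D" if j: "j \<in> {1..r}" for j
    proof -
      have "span (C j) \<subseteq> span D" using j by (intro span_mono) (auto simp: D_def)
      then show ?thesis using C(2)[OF j] proj_in[OF j] by blast
    qed
    then have "(\<Sum>j=1..r. proj j v) \<in> span D" by (rule span_sum)
    then show ?thesis by (simp only: sum_proj)
  qed
  then have "span D = UNIV" by blast
  have "proj i d \<in> \<Lambda>" if d: "d \<in> D" for d
  proof -
    obtain j where j: "j \<in> {1..r}" "d \<in> C j" using d by (auto simp: D_def)
    then have "proj i d = (if i = j then d else 0)"
      using C(1)[OF j(1)] by (intro proj_U i) auto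
    then show ?thesis using d \<open>D \<subseteq> \<Lambda>\<close> lattice_zero by auto
  qed
  then have "proj i ` D \<subseteq> \<Lambda>" by blast
  then obtain m :: nat where m: "m > 0" "integral_map (\<lambda>v. real m *\<^sub>R proj i v)"
    using real_span_imp_integral_multiple[OF \<open>D \<subseteq> \<Lambda>\<close> \<open>span D = UNIV\<close> proj_linear[OF i]] by blast
  have "lattice_endo (\<lambda>v. real m *\<^sub>R proj i v)"
    using m(2) by (simp add: lattice_endo_def equivariant_scaleR proj_equivariant[OF i])
  then show thesis using that m(1) by blast
qed

text \<open>Otherwise there are units \<open>c n\<close> whose restrictions to \<open>U i\<close> have norms \<open>s n > n\<close>. The restrictions divided
by \<open>s n\<close> have a limit point \<open>d'\<close>, which is invertible on \<open>U i\<close> by Schur's lemma. For a nonzero lattice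
vector \<open>w\<close> in \<open>U i\<close> the vector \<open>x\<close> with \<open>c n x = w\<close> is then approximately the inverse of \<open>d'\<close> applied to
\<open>w / s n\<close>, which is too short for a nonzero lattice vector.\<close>

lemma finite_unit_restrictions:
  assumes rat: "\<And>i. i \<in> {1..r} \<Longrightarrow> rational_subspace \<Lambda> (U i)"
    and noniso: "\<And>i j. i \<in> {1..r} \<Longrightarrow> j \<in> {1..r} \<Longrightarrow> i \<noteq> j \<Longrightarrow> \<not> isomorphic_submodules G (U i) (U j)"
    and i: "i \<in> {1..r}"
  shows "finite ((\<lambda>c v. c (proj i v)) ` {c. lattice_unit c})"
proof (rule ccontr)
  let ?e = "proj i"
  assume inf: "infinite ((\<lambda>c v. c (?e v)) ` {c. lattice_unit c})"
  obtain m :: nat where m: "m > 0" "lattice_endo (\<lambda>v. real m *\<^sub>R ?e v)"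
    using integral_proj[OF rat i] by blast
  have unbounded: "\<exists>c. lattice_unit c \<and> opnorm (\<lambda>v. c (?e v)) > real n" for n :: nat
  proof (rule ccontr)
    assume no: "\<not> (\<exists>c. lattice_unit c \<and> opnorm (\<lambda>v. c (?e v)) > real n)"
    define h where "h a = (\<lambda>v. real m *\<^sub>R a v)" for a :: "'a \<Rightarrow> 'a"
    have "inj h"
      using m(1) by (auto simp: inj_def h_def fun_eq_iff)
    have "h (\<lambda>v. c (?e v)) \<in> {a. integral_map a \<and> opnorm a \<le> real m * real n}"
      if c: "lattice_unit c" for c
    proof -
      have eq: "h (\<lambda>v. c (?e v)) = (\<lambda>v. c (real m *\<^sub>R ?e v))"
        using linear_cmul[OF equivariant_linear[OF lattice_endo_equivariant[OF lattice_unit_endo[OF c]]]]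
        by (simp add: h_def)
      have "integral_map (h (\<lambda>v. c (?e v)))"
        unfolding eq using lattice_endo_comp[OF lattice_unit_endo[OF c] m(2)] by (simp add: lattice_endo_def)
      moreover have "opnorm (\<lambda>v. c (?e v)) \<le> real n" using no c by force
      then have "opnorm (h (\<lambda>v. c (?e v))) \<le> real m * real n"
        by (simp add: h_def opnorm_scaleR mult_left_mono)
      ultimately show ?thesis by blast
    qed
    then have "h ` (\<lambda>c v. c (?e v)) ` {c. lattice_unit c} \<subseteq> {a. integral_map a \<and> opnorm a \<le> real m * real n}"
      by blast
    then have "finite (h ` (\<lambda>c v. c (?e v)) ` {c. lattice_unit c})"
      using finite_integral_bounded by (rule finite_subset)
    then show False
      using inf finite_imageD[OF _ inj_on_subset[OF \<open>inj h\<close> subset_UNIV]] by blast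
  qed
  then obtain c where c: "\<And>n :: nat. lattice_unit (c n)" "\<And>n. opnorm (\<lambda>v. c n (?e v)) > real n"
    by metis
  define s where "s n = opnorm (\<lambda>v. c n (?e v))" for n
  have s: "s n > real n" for n using c(2) by (simp add: s_def)
  then have s_pos: "s n > 0" for n by (rule le_less_trans[rotated]) simp
  define d where "d n = (\<lambda>v. (1 / s n) *\<^sub>R c n (?e v))" for n
  have equiv_c: "equivariant (c n)" for n
    by (rule lattice_endo_equivariant[OF lattice_unit_endo[OF c(1)]])
  have equiv_d: "equivariant (d n)" for n
    unfolding d_def by (rule equivariant_scaleR[OF equivariant_comp[OF equiv_c proj_equivariant[OF i]]])
  note lin_d = equivariant_linear[OF equiv_d]
  have norm_d: "opnorm (d n) = 1" for n
    using s_pos[of n] opnorm_scaleR[of "1 / s n" "\<lambda>v. c n (?e v)"] by (simp add: d_def s_def)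
  have norm_d_le: "opnorm (d n) \<le> 1" for n using norm_d by simp
  obtain d' where d': "linear d'" "\<And>\<epsilon> n0. \<epsilon> > 0 \<Longrightarrow> \<exists>n\<ge>n0. opnorm (\<lambda>v. d n v - d' v) < \<epsilon>"
    by (rule opnorm_limit_point[of d 1, OF lin_d norm_d_le]) blast
  have lim: "\<exists>n. opnorm (\<lambda>v. d n v - d' v) < \<epsilon>" if "\<epsilon> > 0" for \<epsilon>
    using d'(2)[OF that, of 0] by blast
  have relation: "a (d' v) = a' (d' w)"
    if "linear a" "linear a'" "\<And>n. a (d n v) = a' (d n w)"
    for a a' :: "'a \<Rightarrow> 'a" and v w
  proof (rule limit_point_relation[of d d'])
    show "\<exists>n. opnorm (\<lambda>v. d n v - d' v) < \<epsilon>" if "\<epsilon> > 0" for \<epsilon>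
      by (rule lim[OF that])
  qed (fact lin_d d'(1) that)+
  note lin_e = proj_linear[OF i]
  have "d' (g v) = g (d' v)" if g: "g \<in> G" for g v
    using relation[of "\<lambda>x. x" g "g v" v] linear_ident G_linear[OF g] equivariant_commute[OF equiv_d g]
    by simp
  then have equiv_d': "equivariant d'" using d'(1) by (simp add: equivariant_def)
  have d'_e: "d' v = d' (?e v)" for v
    using relation[of "\<lambda>x. x" "\<lambda>x. x" v "?e v"] linear_ident by (simp add: d_def proj_idem[OF i])
  have "c n (?e v) \<in> U i" for n v
    by (rule maps_U_to_U[OF noniso equiv_c i proj_in[OF i]])
  then have "?e (c n (?e v)) = c n (?e v)" for n v
    using proj_U[OF i i] by simp
  then have "?e (d' v) = d' v" for v
    using relation[of ?e "\<lambda>x. x" v v] lin_e linear_ident by (simp add: d_def linear_cmul[OF lin_e])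
  then have d'_in: "d' v \<in> U i" for v using proj_in[OF i] by metis
  have "\<exists>v. d' v \<noteq> 0"
  proof (rule ccontr)
    assume "\<not> (\<exists>v. d' v \<noteq> 0)"
    then have "opnorm (\<lambda>v. d n v - d' v) = 1" for n using norm_d[of n] by simp
    then show False using lim[of 1] by simp
  qed
  then obtain v0 where "d' (?e v0) \<noteq> 0" using d'_e by metis
  then have "bij_betw d' (U i) (U i)"
    by (intro schur[OF equiv_d' i i d'_in proj_in[OF i]])
  then obtain q where q: "linear q" "\<And>u. u \<in> U i \<Longrightarrow> q (d' u) = u"
    using linear_exists_left_inverse_on[OF d'(1) subspace_U[OF i]] unfolding bij_betw_def by blast
  obtain w where w: "w \<in> U i" "w \<in> \<Lambda>" "w \<noteq> 0"
  proof -
    obtain C where C: "C \<subseteq> U i \<inter> \<Lambda>" "independent C" "span C = U i"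
      using rat[OF i] by (auto simp: rational_subspace_def)
    have "C \<noteq> {}" using C(3) U_nonzero[OF i] by auto
    then obtain w where "w \<in> C" by blast
    moreover have "w \<noteq> 0" using C(2) \<open>w \<in> C\<close> dependent_zero by blast
    ultimately show thesis using that C(1) by blast
  qed
  \<comment> \<open>The summand \<open>1\<close> only ensures that \<open>Q\<close> is positive.\<close>
  define Q where "Q = opnorm q + 1"
  have Q: "Q > 0" "opnorm q \<le> Q" using opnorm_nonneg[of q] by (simp_all add: Q_def)
  obtain n0 :: nat where n0: "real n0 > 2 * Q * vnorm w" using reals_Archimedean2 by blast
  obtain n where n: "n \<ge> n0" "opnorm (\<lambda>v. d n v - d' v) < 1 / (2 * Q)"
    using d'(2)[of "1 / (2 * Q)" n0] Q(1) by auto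
  obtain b where b: "lattice_unit b" "\<And>v. c n (b v) = v" "\<And>v. b (c n v) = v"
    using lattice_unit_inverse[OF c(1)] by blast
  define x where "x = b w"
  have cx: "c n x = w" by (simp add: x_def b)
  have lin_c: "linear (c n)" by (rule equivariant_linear[OF equiv_c])
  have x: "x \<in> U i" "x \<in> \<Lambda>"
    unfolding x_def
    using maps_U_to_U[OF noniso lattice_endo_equivariant[OF lattice_unit_endo[OF b(1)]] i w(1)]
      lattice_endo_mem[OF lattice_unit_endo[OF b(1)] w(2)] by simp_all
  have "x \<noteq> 0" using cx w(3) linear_0[OF lin_c] by metis
  then have x1: "vnorm x \<ge> 1" by (rule lattice_vnorm_ge_1[OF x(2)])
  have dx: "d n x = (1 / s n) *\<^sub>R w"
    using proj_U[OF i i x(1)] by (simp add: d_def cx)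
  have "x = q (d n x) - q (d n x - d' x)"
    using q(2)[OF x(1)] by (simp add: linear_diff[OF q(1)])
  then have "vnorm x \<le> vnorm (q (d n x)) + vnorm (q (d n x - d' x))"
    using vnorm_triangle_diff by metis
  also have "vnorm (q (d n x)) \<le> Q * ((1 / s n) * vnorm w)"
  proof -
    have "vnorm (q (d n x)) \<le> opnorm q * vnorm (d n x)" by (rule vnorm_apply_le[OF q(1)])
    also have "\<dots> \<le> Q * vnorm (d n x)" by (rule mult_right_mono[OF Q(2) vnorm_nonneg])
    finally show ?thesis using s_pos[of n] by (simp add: dx vnorm_scaleR)
  qed
  also have "vnorm (q (d n x - d' x)) \<le> Q * ((1 / (2 * Q)) * vnorm x)"
  proof -
    have "vnorm (q (d n x - d' x)) \<le> opnorm q * vnorm (d n x - d' x)" by (rule vnorm_apply_le[OF q(1)])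
    also have "\<dots> \<le> Q * vnorm (d n x - d' x)" by (rule mult_right_mono[OF Q(2) vnorm_nonneg])
    also have "vnorm (d n x - d' x) \<le> opnorm (\<lambda>v. d n v - d' v) * vnorm x"
      by (rule vnorm_apply_le[OF linear_compose_sub[OF lin_d d'(1)]])
    also have "opnorm (\<lambda>v. d n v - d' v) * vnorm x \<le> (1 / (2 * Q)) * vnorm x"
      using n(2) by (intro mult_right_mono vnorm_nonneg) simp
    finally show ?thesis using Q(1) by (simp add: mult_left_mono)
  qed
  finally have "vnorm x \<le> Q * vnorm w / s n + vnorm x / 2"
    using Q(1) by simp
  moreover have "Q * vnorm w / s n < 1 / 2"
  proof -
    have "2 * Q * vnorm w < s n" using n0 n(1) s[of n] by linarith
    then show ?thesis using s_pos[of n] by (simp add: field_simps)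
  qed
  ultimately show False using x1 by linarith
qed

lemma finite_units:
  assumes rat: "\<And>i. i \<in> {1..r} \<Longrightarrow> rational_subspace \<Lambda> (U i)"
    and noniso: "\<And>i j. i \<in> {1..r} \<Longrightarrow> j \<in> {1..r} \<Longrightarrow> i \<noteq> j \<Longrightarrow> \<not> isomorphic_submodules G (U i) (U j)"
  shows "finite {c. lattice_unit c}"
proof (rule inj_on_finite)
  let ?f = "\<lambda>c. \<lambda>i\<in>{1..r}. (\<lambda>v. c (proj i v))"
  show "inj_on ?f {c. lattice_unit c}"
  proof (rule inj_onI, rule ext)
    fix c c' v assume cc: "c \<in> {c. lattice_unit c}" "c' \<in> {c. lattice_unit c}" "?f c = ?f c'"
    have lin: "linear b" if "b \<in> {c. lattice_unit c}" for b
      using that by (simp add: equivariant_linear lattice_endo_equivariant lattice_unit_endo)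
    show "c v = c' v"
    proof (rule linear_eq_on_U[OF lin[OF cc(1)] lin[OF cc(2)]])
      fix i u assume iu: "i \<in> {1..r}" "u \<in> U i"
      have "c (proj i u) = c' (proj i u)"
        using fun_cong[OF fun_cong[OF cc(3), of i], of u] iu(1) by simp
      then show "c u = c' u" using proj_U[OF iu(1) iu] by simp
    qed
  qed
  show "?f ` {c. lattice_unit c} \<subseteq> (\<Pi>\<^sub>E i\<in>{1..r}. (\<lambda>c v. c (proj i v)) ` {c. lattice_unit c})"
    by (intro image_subsetI) (simp only: restrict_PiE_iff, blast)
  show "finite (\<Pi>\<^sub>E i\<in>{1..r}. (\<lambda>c v. c (proj i v)) ` {c. lattice_unit c})"
    by (intro finite_PiE finite_unit_restrictions[OF rat noniso]) simp_all
qed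

end

section \<open>The normalizer and the centralizer\<close>

context lattice_group begin

lemma GL_lattice_mem:
  assumes "linear S" "\<And>v. v \<in> \<Lambda> \<Longrightarrow> S v \<in> \<Lambda>" "\<And>v. v \<in> \<Lambda> \<Longrightarrow> T v \<in> \<Lambda>"
    "\<And>v. S (T v) = v" "\<And>v. T (S v) = v"
  shows "S \<in> carrier (GL_lattice \<Lambda>)"
proof -
  have "bij S" using assms(4,5) by (intro o_bij[of T]) (auto simp: fun_eq_iff)
  moreover have "S ` \<Lambda> = \<Lambda>"
  proof
    show "S ` \<Lambda> \<subseteq> \<Lambda>" using assms(2) by blast
    show "\<Lambda> \<subseteq> S ` \<Lambda>"
    proof
      fix v assume "v \<in> \<Lambda>"
      then show "v \<in> S ` \<Lambda>" using assms(3)[of v] assms(4)[of v] by (metis imageI)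
    qed
  qed
  ultimately show ?thesis using assms(1) by (simp add: GL_lattice_def)
qed

lemma normalizer_iff:
  "S \<in> lattice_normalizer \<Lambda> G \<longleftrightarrow> S \<in> carrier (GL_lattice \<Lambda>) \<and> (\<forall>g\<in>G. (\<lambda>v. ginv S (g (S v))) \<in> G)"
proof -
  have "inv\<^bsub>GL_lattice \<Lambda>\<^esub> S \<otimes>\<^bsub>GL_lattice \<Lambda>\<^esub> g \<otimes>\<^bsub>GL_lattice \<Lambda>\<^esub> S = (\<lambda>v. ginv S (g (S v)))"
    if "S \<in> carrier (GL_lattice \<Lambda>)" for g
    unfolding GL_inv[OF that] by (simp add: GL_lattice_def o_def)
  then show ?thesis by (auto simp: lattice_normalizer_def)
qed

lemma lattice_unit_normalizes:
  assumes "lattice_unit c"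
  shows "c \<in> lattice_normalizer \<Lambda> G"
  unfolding normalizer_iff
proof (intro conjI ballI)
  obtain b where b: "lattice_unit b" "\<And>v. c (b v) = v" "\<And>v. b (c v) = v"
    using lattice_unit_inverse[OF assms] by blast
  note endo = lattice_unit_endo[OF assms]
  show "c \<in> carrier (GL_lattice \<Lambda>)"
    by (rule GL_lattice_mem[of c b])
      (simp_all add: equivariant_linear lattice_endo_equivariant lattice_endo_mem endo lattice_unit_endo b)
  then have "inj c" by (simp add: GL_lattice_def bij_is_inj)
  fix g assume g: "g \<in> G"
  have "(\<lambda>v. ginv c (g (c v))) = g"
    by (simp only: equivariant_commute[OF lattice_endo_equivariant[OF endo] g, symmetric] inv_f_f[OF \<open>inj c\<close>])
  then show "(\<lambda>v. ginv c (g (c v))) \<in> G" using g by simp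
qed

text \<open>The quotient \<open>S T\<^sup>-\<^sup>1\<close> centralizes \<open>G\<close>.\<close>

lemma same_conjugation_unit:
  assumes S: "S \<in> carrier (GL_lattice \<Lambda>)" and T: "T \<in> carrier (GL_lattice \<Lambda>)"
    and eq: "\<And>g v. g \<in> G \<Longrightarrow> ginv S (g (S v)) = ginv T (g (T v))"
  shows "\<exists>c. lattice_unit c \<and> S = (\<lambda>v. c (T v))"
proof -
  have props: "linear R" "R (ginv R v) = v" "ginv R (R v) = v" "linear (ginv R)"
    "u \<in> \<Lambda> \<Longrightarrow> R u \<in> \<Lambda>" "u \<in> \<Lambda> \<Longrightarrow> ginv R u \<in> \<Lambda>"
    if R: "R \<in> carrier (GL_lattice \<Lambda>)" for R v u
  proof -
    interpret group "GL_lattice \<Lambda>" by (rule group_GL_lattice)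
    have R': "ginv R \<in> carrier (GL_lattice \<Lambda>)" using inv_closed[OF R] by (simp add: GL_inv[OF R])
    show "linear R" "linear (ginv R)" "u \<in> \<Lambda> \<Longrightarrow> R u \<in> \<Lambda>" "u \<in> \<Lambda> \<Longrightarrow> ginv R u \<in> \<Lambda>"
      using R R' by (auto simp: GL_lattice_def)
    show "R (ginv R v) = v" "ginv R (R v) = v"
      using R by (simp_all add: GL_lattice_def bij_is_inj bij_is_surj surj_f_inv_f)
  qed
  have endo: "lattice_endo (\<lambda>v. S (ginv T v))"
    if S: "S \<in> carrier (GL_lattice \<Lambda>)" and T: "T \<in> carrier (GL_lattice \<Lambda>)"
      and eq: "\<And>g v. g \<in> G \<Longrightarrow> ginv S (g (S v)) = ginv T (g (T v))" for S T
  proof (rule lattice_endoI)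
    show "S (ginv T v) \<in> \<Lambda>" if "v \<in> \<Lambda>" for v
      by (rule props(5)[OF S props(6)[OF T that]])
    have "linear (\<lambda>v. S (ginv T v))"
      using linear_compose[OF props(4)[OF T] props(1)[OF S]] by (simp add: o_def)
    moreover have "S (ginv T (g v)) = g (S (ginv T v))" if g: "g \<in> G" for g v
    proof -
      have "ginv S (g (S (ginv T v))) = ginv T (g v)"
        using eq[OF g, of "ginv T v"] by (simp only: props(2)[OF T])
      then show ?thesis using props(2)[OF S] by metis
    qed
    ultimately show "equivariant (\<lambda>v. S (ginv T v))" by (simp add: equivariant_def)
  qed
  have "lattice_unit (\<lambda>v. S (ginv T v))"
    unfolding lattice_unit_def
    using endo[OF S T eq] endo[OF T S eq[symmetric]]
    by (intro conjI exI[of _ "\<lambda>v. T (ginv S v)"]) (simp_all add: props S T)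
  moreover have "S = (\<lambda>v. S (ginv T (T v)))" by (simp add: props T)
  ultimately show ?thesis by blast
qed

text \<open>The units are exactly the elements of the centralizer of \<open>G\<close> in \<open>GL(\<Lambda>)\<close>. It lies in the normalizer, and its
cosets there are the fibres of the map that sends \<open>S\<close> to the conjugation by \<open>S\<close> on \<open>G\<close>.\<close>

lemma finite_normalizer_iff: "finite (lattice_normalizer \<Lambda> G) \<longleftrightarrow> finite {c. lattice_unit c}"
proof
  assume "finite (lattice_normalizer \<Lambda> G)"
  then show "finite {c. lattice_unit c}"
    by (rule finite_subset[rotated]) (use lattice_unit_normalizes in blast)
next
  assume fin: "finite {c. lattice_unit c}"
  define N where "N = lattice_normalizer \<Lambda> G"
  define \<Phi> where "\<Phi> S = (\<lambda>g\<in>G. (\<lambda>v. ginv S (g (S v))))" for S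
  have N: "S \<in> carrier (GL_lattice \<Lambda>)" "g \<in> G \<Longrightarrow> (\<lambda>v. ginv S (g (S v))) \<in> G" if "S \<in> N" for S g
    using that by (simp_all add: N_def normalizer_iff)
  have "\<Phi> ` N \<subseteq> (\<Pi>\<^sub>E g\<in>G. G)"
    using N(2) unfolding \<Phi>_def by (intro image_subsetI) (simp only: restrict_PiE_iff, simp)
  then have fin\<Phi>: "finite (\<Phi> ` N)"
    by (rule finite_subset) (simp add: finite_PiE finite_G)
  define rep where "rep k = (SOME S. S \<in> N \<and> \<Phi> S = k)" for k
  have rep: "rep (\<Phi> S) \<in> N \<and> \<Phi> (rep (\<Phi> S)) = \<Phi> S" if "S \<in> N" for S
    unfolding rep_def by (rule someI[of _ S]) (simp add: that)
  have "N \<subseteq> (\<lambda>(k, c). (\<lambda>v. c (rep k v))) ` (\<Phi> ` N \<times> {c. lattice_unit c})"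
  proof
    fix S assume S: "S \<in> N"
    let ?T = "rep (\<Phi> S)"
    have "ginv S (g (S v)) = ginv ?T (g (?T v))" if "g \<in> G" for g v
    proof -
      have "\<Phi> S g = \<Phi> ?T g" using rep[OF S] by simp
      then show ?thesis using that by (simp add: \<Phi>_def fun_eq_iff)
    qed
    then obtain c where "lattice_unit c" "S = (\<lambda>v. c (?T v))"
      using same_conjugation_unit[OF N(1)[OF S] N(1), of ?T] rep[OF S] by blast
    then show "S \<in> (\<lambda>(k, c). (\<lambda>v. c (rep k v))) ` (\<Phi> ` N \<times> {c. lattice_unit c})"
      using S by (intro image_eqI[of _ _ "(\<Phi> S, c)"]) auto
  qed
  then have "finite N"
    by (rule finite_subset) (intro finite_imageI finite_cartesian_product fin\<Phi> fin)
  then show "finite (lattice_normalizer \<Lambda> G)" by (simp add: N_def)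
qed

end

theorem theorem4p1:
  fixes \<Lambda> :: "'v::real_vector set"
    and G :: "('v \<Rightarrow> 'v) set"
    and U :: "nat \<Rightarrow> 'v set"
    and r :: nat
  assumes finite_dim: "\<exists>B::'v set. finite B \<and> span B = UNIV"
    and lattice: "full_lattice \<Lambda>"
    and finite_G: "finite G"
    and subgroup_G: "subgroup G (GL_lattice \<Lambda>)"
    and decomposition: "internal_direct_sum r U"
    and irreducible: "\<forall>i\<in>{1..r}. irreducible_subspace G (U i)"
  shows "finite (lattice_normalizer \<Lambda> G) \<longleftrightarrow>
    (\<forall>i\<in>{1..r}. rational_subspace \<Lambda> (U i)) \<and>
    (\<forall>i\<in>{1..r}. \<forall>j\<in>{1..r}. i \<noteq> j \<longrightarrow> \<not> isomorphic_submodules G (U i) (U j))"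
proof -
  obtain B where B: "independent B" "span B = UNIV" and \<Lambda>: "\<Lambda> = int_span B"
    using lattice by (auto simp: full_lattice_def)
  obtain T :: "'v set" where "finite T" "span T = UNIV" using finite_dim by blast
  then have "finite B"
    using real_vector.independent_span_bound[OF _ B(1), of T] by simp
  interpret lattice_decomposition B G U r
    using \<open>finite B\<close> B finite_G subgroup_G[unfolded \<Lambda>] decomposition irreducible
    by (intro lattice_decomposition.intro lattice_group.intro lattice_basis.intro
        lattice_group_axioms.intro lattice_decomposition_axioms.intro) blast+
  show ?thesis
    unfolding \<Lambda> finite_normalizer_iff
    using rational_simple non_isomorphic finite_units by blast
qed

end
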